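(* Let $G=(V,w)$ be a countable weighted graph over a countably infinite set $V$, with weight function $w:V\times V\to\mathbb C$, and let $S\subset V$ be a finite set. Assume that (i) $w$ is $(1,\infty)$-bounded, and (ii) $S$ is a structural set of type A quasi-B for $w$. Put $\Sigma=\{0\}$. Then: (1) $\operatorname{sp}(\mathscr A_w)\setminus\Sigma=\operatorname{sp}(\mathscr R_{S,w})$. (2) Given $\lambda_0\in\mathbb C\setminus\Sigma$, $\lambda_0$ is an eigenvalue of $\mathscr A_w$ if and only if $\lambda_0$ is an eigenvalue of $\mathscr R_{S,w}(\lambda_0)$. (3) If $\lambda_0\in\mathbb C\setminus\Sigma$ is an eigenvalue of $\mathscr A_w$ and $u\in L^1(V)$ is an associated eigenfunction, $\mathscr A_wu=\lambda_0u$, then $\mathscr R_{S,w}(\lambda_0)u_S=\lambda_0u_S$, i.e. $u_S$ is the corresponding eigenfunction for $\mathscr R_{S,w}(\lambda_0)$, where $u_S$ is the restriction of $u$ to $S$. (4) If $\lambda_0\in\mathbb C\setminus\Sigma$ is an eigenvalue of $\mathscr R_{S,w}(\lambda_0)$ and $v$ is an associated eigenfunction, $\mathscr R_{S,w}(\lambda_0)v=\lambda_0v$, then $u=\Phi_{S,w}(\lambda_0)(v)$ is an eigenfunction of $\mathscr A_w$, i.e. $\mathscr A_wu=\lambda_0u$.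
   Context: $L^1(V)=\{f:V\to\mathbb C:\|f\|_1=\sum_{i\in V}|f(i)|<\infty\}$. A weight function $w:V\times V\to\mathbb C$ is $(1,\infty)$-bounded if $\|w\|_{1,\infty}:=\sup_{j\in V}\sum_{i\in V}|w(i,j)|<\infty$; it then determines the bounded operator $\mathscr A_w:L^1(V)\to L^1(V)$, $(\mathscr A_wf)(i)=\sum_{j\in V}w(i,j)f(j)$. The weight $w$ is identified with the kernel $K(i,\cdot)=\sum_jw(i,j)\delta_j$, the reference measure on $V$ being counting measure, and the diagonal function $d$ of the general theory being $0$. Write $S^c=V\setminus S$. Reduced operator: for $\lambda\in\mathbb C\setminus\{0\}$, $\mathscr R_{S,w}(\lambda):\mathbb C^S\to\mathbb C^S$ is the operator with matrix $$R_{S,\lambda}(i,j)=w(i,j)+\sum_{n\ge2}\lambda^{-(n-1)}\sum_{z_1,\dots,z_{n-1}\in S^c}w(i,z_1)w(z_1,z_2)\cdots w(z_{n-1},j),\quad i,j\in S$$ (the paper shows that the series converges for structural sets of type A or B). $\operatorname{sp}(\mathscr R_{S,w})$ is the set of $\lambda\in\mathbb C\setminus\{0\}$ such that $\mathscr R_{S,w}(\lambda)-\lambda I$ is not invertible. Structural set of type A for $w$: with $\tau_{S,n}(i,j)=\sum_{z_1,\dots,z_{n-1}\in S^c}w(i,z_1)w(z_1,z_2)\cdots w(z_{n-1},j)$, a nonempty $S$ is of type A if there exist a sequence $t_n>0$ with $\lim_{n\to\infty}\frac1n\log t_n=-\infty$ and a function $M:V\times V\to[0,\infty)$ with $\sup_j\sum_iM(i,j)<\infty$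 such that $|\tau_{S,n}(i,j)|\le t_nM(i,j)$ for all $i,j\in V$ and $n\ge2$ (equivalently, $|\sum_{j\in B}\tau_{S,n}(i,j)|\le t_n\sum_{j\in B}M(i,j)$ for all $B\subseteq V$ with finite right-hand side). Structural set of type B for $w$: a nonempty $S$ is of type B if there is $M:S^c\to[0,\infty)$ such that, with $\varphi(i)=\{j\in S^c:w(i,j)\ne0\}$ for $i\in S^c$ and iterates $\varphi^0(i)=\{i\}$, $\varphi^n(i)=\bigcup_{j\in\varphi^{n-1}(i)}\varphi(j)$: (1) for every $i\in S^c$ there is $n\in\mathbb N$ with $\varphi^n(i)=\emptyset$; (2) $|w(i,j)|\le M(i)$ for all $i,j\in S^c$; (3) with $n_S(i)=\min\{k\in\mathbb N:\varphi^k(i)=\emptyset\}$, $\sum_{i\in S^c}n_S(i)M(i)<\infty$. Structural set of type A quasi-B for $w$: there is a sequence of $(1,\infty)$-bounded weight functions $w_n:V\times V\to\mathbb C$, $n\in\mathbb N$, such that $S$ is of type A for $w$, $\lim_{n\to\infty}\|w-w_n\|_{1,\infty}=0$, and $S$ is of type B for every $w_n$. Reconstruction operators: if $S$ is of type B for a weight $w'$, let $S_0=S$, $S_m=\{i\in V:w'(i,j)=0\ \forall j\in V\setminus S_{m-1}\}\cup S_{m-1}$; for $\lambda\ne0$ and $v\in\mathbb C^S$, $\Phi_{S,w'}(\lambda)(v)\in L^1(V)$ is the function $u$ with $u=v$ on $S$ and $u(i)=\lambda^{-1}\sum_{j\in S_{m-1}}w'(i,j)u(j)$ for $i\in S_m\setminus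 S_{m-1}$, $m\ge1$. For $S$ of type A quasi-B for $w$ with approximating weights $w_n$, $\Phi_{S,w}(\lambda)(v):=\lim_{n\to\infty}\Phi_{S,w_n}(\lambda)(v)$ in $L^1(V)$ (the paper shows that the limit exists). *)

theory Defs
  imports "HOL-Analysis.Analysis"
begin

section \<open>The space $L^1(V)$ and operators on it\<close>

text \<open>The vertex set $V$ is the universe of the type variable \<open>'v\<close>. Norms take values in
  \<^typ>\<open>ennreal\<close>, so that a divergent sum has norm \<open>\<infinity>\<close> instead of a default real value.\<close>

definition l1_norm :: "('v \<Rightarrow> 'a::real_normed_vector) \<Rightarrow> ennreal" where
  "l1_norm f = (\<Sum>\<^sub>\<infinity>i. ennreal (norm (f i)))"

definition L1 :: "('v \<Rightarrow> complex) set" where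
  "L1 = {f. l1_norm f < \<infinity>}"

definition norm_1inf :: "('v \<Rightarrow> 'v \<Rightarrow> 'a::real_normed_vector) \<Rightarrow> ennreal" where
  "norm_1inf w = (SUP j. l1_norm (\<lambda>i. w i j))"

definition bounded_1inf :: "('v \<Rightarrow> 'v \<Rightarrow> 'a::real_normed_vector) \<Rightarrow> bool" where
  "bounded_1inf w \<longleftrightarrow> norm_1inf w < \<infinity>"

text \<open>An operator on $L^1(V)$ is a map on all functions \<open>'v \<Rightarrow> complex\<close>, of which only the values
  on \<open>L1\<close> matter.\<close>

definition weight_op :: "('v \<Rightarrow> 'v \<Rightarrow> complex) \<Rightarrow> ('v \<Rightarrow> complex) \<Rightarrow> 'v \<Rightarrow> complex" where
  "weight_op w f = (\<lambda>i. \<Sum>\<^sub>\<infinity>j. w i j * f j)"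

definition L1_bounded_op :: "(('v \<Rightarrow> complex) \<Rightarrow> 'v \<Rightarrow> complex) \<Rightarrow> bool" where
  "L1_bounded_op T \<longleftrightarrow>
     (\<forall>f\<in>L1. T f \<in> L1) \<and>
     (\<forall>f\<in>L1. \<forall>g\<in>L1. T (\<lambda>i. f i + g i) = (\<lambda>i. T f i + T g i)) \<and>
     (\<forall>c. \<forall>f\<in>L1. T (\<lambda>i. c * f i) = (\<lambda>i. c * T f i)) \<and>
     (\<exists>C::real. \<forall>f\<in>L1. l1_norm (T f) \<le> ennreal C * l1_norm f)"

definition L1_invertible :: "(('v \<Rightarrow> complex) \<Rightarrow> 'v \<Rightarrow> complex) \<Rightarrow> bool" where
  "L1_invertible T \<longleftrightarrow>
     (\<exists>U. L1_bounded_op U \<and> (\<forall>f\<in>L1. U (T f) = f) \<and> (\<forall>f\<in>L1. T (U f) = f))"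

definition L1_spectrum :: "(('v \<Rightarrow> complex) \<Rightarrow> 'v \<Rightarrow> complex) \<Rightarrow> complex set" where
  "L1_spectrum T = {l. \<not> L1_invertible (\<lambda>f i. T f i - l * f i)}"

definition L1_eigenfunction ::
    "(('v \<Rightarrow> complex) \<Rightarrow> 'v \<Rightarrow> complex) \<Rightarrow> complex \<Rightarrow> ('v \<Rightarrow> complex) \<Rightarrow> bool" where
  "L1_eigenfunction T l u \<longleftrightarrow> u \<in> L1 \<and> u \<noteq> (\<lambda>_. 0) \<and> T u = (\<lambda>i. l * u i)"

definition L1_eigenvalue :: "(('v \<Rightarrow> complex) \<Rightarrow> 'v \<Rightarrow> complex) \<Rightarrow> complex \<Rightarrow> bool" where
  "L1_eigenvalue T l \<longleftrightarrow> (\<exists>u. L1_eigenfunction T l u)"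


section \<open>The reduced operator\<close>

definition path_weight :: "('v \<Rightarrow> 'v \<Rightarrow> complex) \<Rightarrow> 'v \<Rightarrow> 'v list \<Rightarrow> 'v \<Rightarrow> complex" where
  "path_weight w i zs j = prod_list (map2 w (i # zs) (zs @ [j]))"

text \<open>$\tau_{S,n}(i,j)$: the tuple $(z_1,\dots,z_{n-1})$ of vertices of $S^c$ is a list of
  length \<open>n - 1\<close>; only \<open>n \<ge> 2\<close> is used.\<close>

definition tau :: "('v \<Rightarrow> 'v \<Rightarrow> complex) \<Rightarrow> 'v set \<Rightarrow> nat \<Rightarrow> 'v \<Rightarrow> 'v \<Rightarrow> complex" where
  "tau w S n i j = (\<Sum>\<^sub>\<infinity>zs\<in>{zs. length zs = n - 1 \<and> set zs \<subseteq> - S}. path_weight w i zs j)"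

text \<open>The summation index \<open>n\<close> is shifted by 2 with respect to $\sum_{n\ge2}\lambda^{-(n-1)}\tau_{S,n}$.\<close>

definition reduced_matrix ::
    "('v \<Rightarrow> 'v \<Rightarrow> complex) \<Rightarrow> 'v set \<Rightarrow> complex \<Rightarrow> 'v \<Rightarrow> 'v \<Rightarrow> complex" where
  "reduced_matrix w S l i j = w i j + (\<Sum>n. tau w S (n + 2) i j / l ^ (n + 1))"

text \<open>$\mathbb C^S$ is the set \<open>S \<rightarrow>\<^sub>E UNIV\<close> of functions on \<open>S\<close> (equal to \<open>undefined\<close> off \<open>S\<close>).\<close>

definition reduced_op ::
    "('v \<Rightarrow> 'v \<Rightarrow> complex) \<Rightarrow> 'v set \<Rightarrow> complex \<Rightarrow> ('v \<Rightarrow> complex) \<Rightarrow> 'v \<Rightarrow> complex" where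
  "reduced_op w S l v = (\<lambda>i\<in>S. \<Sum>j\<in>S. reduced_matrix w S l i j * v j)"

definition reduced_spectrum :: "('v \<Rightarrow> 'v \<Rightarrow> complex) \<Rightarrow> 'v set \<Rightarrow> complex set" where
  "reduced_spectrum w S =
     {l. l \<noteq> 0 \<and>
         \<not> bij_betw (\<lambda>v. \<lambda>i\<in>S. reduced_op w S l v i - l * v i) (S \<rightarrow>\<^sub>E UNIV) (S \<rightarrow>\<^sub>E UNIV)}"

definition fin_eigenfunction ::
    "'v set \<Rightarrow> (('v \<Rightarrow> complex) \<Rightarrow> 'v \<Rightarrow> complex) \<Rightarrow> complex \<Rightarrow> ('v \<Rightarrow> complex) \<Rightarrow> bool" where
  "fin_eigenfunction S T l v \<longleftrightarrow>
     v \<in> S \<rightarrow>\<^sub>E UNIV \<and> (\<exists>i\<in>S. v i \<noteq> 0) \<and> T v = (\<lambda>i\<in>S. l * v i)"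

definition fin_eigenvalue ::
    "'v set \<Rightarrow> (('v \<Rightarrow> complex) \<Rightarrow> 'v \<Rightarrow> complex) \<Rightarrow> complex \<Rightarrow> bool" where
  "fin_eigenvalue S T l \<longleftrightarrow> (\<exists>v. fin_eigenfunction S T l v)"


section \<open>Structural sets\<close>

definition structural_A :: "('v \<Rightarrow> 'v \<Rightarrow> complex) \<Rightarrow> 'v set \<Rightarrow> bool" where
  "structural_A w S \<longleftrightarrow> S \<noteq> {} \<and>
     (\<exists>(t :: nat \<Rightarrow> real) (M :: 'v \<Rightarrow> 'v \<Rightarrow> real).
        (\<forall>n. t n > 0) \<and> filterlim (\<lambda>n. ln (t n) / real n) at_bot sequentially \<and>
        (\<forall>i j. M i j \<ge> 0) \<and> bounded_1inf M \<and>
        (\<forall>i j. \<forall>n\<ge>2. norm (tau w S n i j) \<le> t n * M i j))"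

definition succs :: "('v \<Rightarrow> 'v \<Rightarrow> complex) \<Rightarrow> 'v set \<Rightarrow> 'v \<Rightarrow> 'v set" where
  "succs w S i = {j \<in> - S. w i j \<noteq> 0}"

primrec succs_iter :: "('v \<Rightarrow> 'v \<Rightarrow> complex) \<Rightarrow> 'v set \<Rightarrow> nat \<Rightarrow> 'v \<Rightarrow> 'v set" where
  "succs_iter w S 0 i = {i}"
| "succs_iter w S (Suc n) i = (\<Union>j\<in>succs_iter w S n i. succs w S j)"

definition depth :: "('v \<Rightarrow> 'v \<Rightarrow> complex) \<Rightarrow> 'v set \<Rightarrow> 'v \<Rightarrow> nat" where
  "depth w S i = (LEAST k. succs_iter w S k i = {})"

definition structural_B :: "('v \<Rightarrow> 'v \<Rightarrow> complex) \<Rightarrow> 'v set \<Rightarrow> bool" where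
  "structural_B w S \<longleftrightarrow> S \<noteq> {} \<and>
     (\<exists>M :: 'v \<Rightarrow> real.
        (\<forall>i\<in>-S. M i \<ge> 0) \<and>
        (\<forall>i\<in>-S. \<exists>n. succs_iter w S n i = {}) \<and>
        (\<forall>i\<in>-S. \<forall>j\<in>-S. norm (w i j) \<le> M i) \<and>
        (\<lambda>i. real (depth w S i) * M i) summable_on (- S))"

definition structural_A_quasi_B_via ::
    "('v \<Rightarrow> 'v \<Rightarrow> complex) \<Rightarrow> 'v set \<Rightarrow> (nat \<Rightarrow> 'v \<Rightarrow> 'v \<Rightarrow> complex) \<Rightarrow> bool" where
  "structural_A_quasi_B_via w S W \<longleftrightarrow>
     (\<forall>n. bounded_1inf (W n)) \<and>
     structural_A w S \<and>
     (\<lambda>n. norm_1inf (\<lambda>i j. w i j - W n i j)) \<longlonglongrightarrow> 0 \<and>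
     (\<forall>n. structural_B (W n) S)"

definition structural_A_quasi_B :: "('v \<Rightarrow> 'v \<Rightarrow> complex) \<Rightarrow> 'v set \<Rightarrow> bool" where
  "structural_A_quasi_B w S \<longleftrightarrow> (\<exists>W. structural_A_quasi_B_via w S W)"


section \<open>Reconstruction operators\<close>

primrec layer :: "('v \<Rightarrow> 'v \<Rightarrow> complex) \<Rightarrow> 'v set \<Rightarrow> nat \<Rightarrow> 'v set" where
  "layer w S 0 = S"
| "layer w S (Suc m) = {i. \<forall>j\<in>- layer w S m. w i j = 0} \<union> layer w S m"

text \<open>\<open>recon_upto w S l v m\<close> is the reconstructed function on $S_m$, extended by 0.\<close>

primrec recon_upto ::
    "('v \<Rightarrow> 'v \<Rightarrow> complex) \<Rightarrow> 'v set \<Rightarrow> complex \<Rightarrow> ('v \<Rightarrow> complex) \<Rightarrow> nat \<Rightarrow> 'v \<Rightarrow> complex" where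
  "recon_upto w S l v 0 = (\<lambda>i. if i \<in> S then v i else 0)"
| "recon_upto w S l v (Suc m) = (\<lambda>i.
     if i \<in> layer w S m then recon_upto w S l v m i
     else if i \<in> layer w S (Suc m)
       then inverse l * (\<Sum>\<^sub>\<infinity>j\<in>layer w S m. w i j * recon_upto w S l v m j)
     else 0)"

text \<open>For \<open>S\<close> of type B the sets $S_m$ exhaust $V$, so every \<open>i\<close> lies in a first layer.\<close>

definition recon_B ::
    "('v \<Rightarrow> 'v \<Rightarrow> complex) \<Rightarrow> 'v set \<Rightarrow> complex \<Rightarrow> ('v \<Rightarrow> complex) \<Rightarrow> 'v \<Rightarrow> complex" where
  "recon_B w S l v i = recon_upto w S l v (LEAST m. i \<in> layer w S m) i"

lemma layer_mono: "m \<le> n \<Longrightarrow> layer w S m \<subseteq> layer w S n"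
  by (rule lift_Suc_mono_le[of "layer w S"]) auto

lemma recon_upto_mono:
  assumes "m \<le> n" "i \<in> layer w S m"
  shows "recon_upto w S l v n i = recon_upto w S l v m i"
  using assms(1)
proof (induction n rule: dec_induct)
  case (step n)
  then show ?case using layer_mono[of m n w S] assms(2) by auto
qed simp

lemma recon_B_eq_upto:
  assumes "i \<in> layer w S m"
  shows "recon_B w S l v i = recon_upto w S l v m i"
  unfolding recon_B_def
  using recon_upto_mono[OF Least_le[of "\<lambda>m. i \<in> layer w S m", OF assms]] LeastI[of "\<lambda>m. i \<in> layer w S m", OF assms]
  by metis

text \<open>The defining equations of $\Phi_{S,w'}(\lambda)(v)$.\<close>

lemma recon_B_base: "i \<in> S \<Longrightarrow> recon_B w S l v i = v i"
  using recon_B_eq_upto[of i w S 0] by simp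

lemma recon_B_step:
  assumes "i \<in> layer w S (Suc m) - layer w S m"
  shows "recon_B w S l v i = inverse l * (\<Sum>\<^sub>\<infinity>j\<in>layer w S m. w i j * recon_B w S l v j)"
proof -
  have "(\<Sum>\<^sub>\<infinity>j\<in>layer w S m. w i j * recon_B w S l v j)
      = (\<Sum>\<^sub>\<infinity>j\<in>layer w S m. w i j * recon_upto w S l v m j)"
    by (intro infsum_cong) (simp add: recon_B_eq_upto)
  with assms show ?thesis
    using recon_B_eq_upto[of i w S "Suc m" l v] by auto
qed

lemma layer_exhausts:
  assumes "structural_B w S"
  shows "\<exists>m. i \<in> layer w S m"
proof -
  have shift: "succs_iter w S (Suc n) i = (\<Union>j\<in>succs w S i. succs_iter w S n j)" for n i
    by (induction n) auto
  have "succs_iter w S n i = {} \<Longrightarrow> i \<in> layer w S n" for n i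
  proof (induction n arbitrary: i)
    case (Suc n)
    have "w i j = 0" if "j \<in> - layer w S n" for j
      using Suc that layer_mono[of 0 n w S] unfolding shift succs_def by auto
    then show ?case by simp
  qed simp
  moreover have "\<exists>n. succs_iter w S n i = {}" if "i \<notin> S"
    using assms that unfolding structural_B_def by blast
  ultimately show ?thesis by (metis layer.simps(1))
qed

text \<open>$\Phi_{S,w}(\lambda)(v)$ for approximating weights \<open>W\<close>: the limit in $L^1(V)$.\<close>

definition recon_limit ::
    "(nat \<Rightarrow> 'v \<Rightarrow> 'v \<Rightarrow> complex) \<Rightarrow> 'v set \<Rightarrow> complex \<Rightarrow> ('v \<Rightarrow> complex) \<Rightarrow> 'v \<Rightarrow> complex" where
  "recon_limit W S l v =
     (THE u. u \<in> L1 \<and> (\<lambda>n. l1_norm (\<lambda>i. recon_B (W n) S l v i - u i)) \<longlonglongrightarrow> 0)"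

end

theory Submission
  imports Defs
begin

text \<open>Write $T$ for $\mathscr A_w$, $C$ for multiplication by $1_{S^c}$, and extend the reduced matrix
  to a kernel $Q = \sum_{n\ge0} \lambda^{-n}\, T (CT)^n$ on all of $V \times V$. Type A makes $Q$ a
  bounded operator, and $TCQ = \lambda (Q - T) = QCT$. Consequently $Tu - \lambda u = f$ is equivalent
  to $Q 1_S u = \lambda u + h$ with $h = f + \lambda^{-1} QCf$: restricted to $S$ this is the reduced
  equation $(\mathscr R - \lambda) u_S = h_S$, and off $S$ it expresses $u$ by $u_S$.
  An eigenfunction $v$ of $\mathscr R$ thus lifts to $u = \lambda^{-1} Q v$. The reconstruction for an
  approximating weight $w_n$ is the solution of $g = v$ on $S$, $\lambda g = \mathscr A_{w_n} g$ off $S$.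
  As $1 + \lambda^{-1} CQ$ inverts $1 - \lambda^{-1} CT$, this is the fixed-point equation
  $g = u + \lambda^{-1}(1 + \lambda^{-1} CQ)\, C (\mathscr A_{w_n} - T) g$, a contraction for
  large $n$ whose solution tends to $u$.\<close>

section \<open>Kernels with bounded column sums\<close>

text \<open>The passage to the reduced equation is multiplication by an invertible operator. From
  TCQ = QCT = l (Q - T), the operator 1 + QC/l is a two-sided inverse of 1 - TC/l, and (1 + QC/l) T
  = Q. Applied to T 1_S u - l (1 - TC/l) u = f it yields Q 1_S u - l u = h. The series for Q
  converges for every nonzero l because t_n decays faster than any geometric sequence while one
  column-summable M dominates all terms: the majorant is a product of a function of n and a function
  of the vertices, so sums over n and over vertices can be exchanged. Finiteness of S enters twice:
  a vector of C^S extended by zero lies in \<open>L1\<close>, and the inverse on C^S has an explicit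
  bound. The type B data of the approximating weights come with no uniformity in n, so the
  reconstructions are not estimated layer by layer. They are identified as the solutions of their
  defining equations, into which the approximation enters only through its difference from
  w.\<close>

no_notation Infinite_Set_Sum.abs_summable_on (infix "abs'_summable'_on" 50)

text \<open>A real upper bound, not necessarily sharp, for \<open>norm_1inf K\<close>, so that
  estimates stay in real arithmetic. The value type is general because the majorant of type A is
  real-valued.\<close>

definition bounded_kernel :: "('v \<Rightarrow> 'v \<Rightarrow> 'a::real_normed_vector) \<Rightarrow> real \<Rightarrow> bool" where
  "bounded_kernel K c \<longleftrightarrow>
     (\<forall>j. (\<lambda>i. K i j) abs_summable_on UNIV \<and> (\<Sum>\<^sub>\<infinity>i. norm (K i j)) \<le> c)"

text \<open>Multiplication by the indicator of \<open>A\<close>. For \<open>A = - S\<close> it is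
  the operator C of the overview, which is distinct from the real bound \<open>C\<close> in
  \<open>reduced_kernel\<close>.\<close>

definition trunc_on :: "'v set \<Rightarrow> ('v \<Rightarrow> complex) \<Rightarrow> 'v \<Rightarrow> complex" where
  "trunc_on A f i = (if i \<in> A then f i else 0)"

section \<open>Passing between extended and real norms\<close>

lemma l1_norm_abs_summable:
  fixes f :: "'v \<Rightarrow> 'a::real_normed_vector"
  assumes "f abs_summable_on UNIV"
  shows "l1_norm f = ennreal (\<Sum>\<^sub>\<infinity>i. norm (f i))"
  unfolding l1_norm_def infsum_nonneg_is_SUPREMUM_ennreal[OF assms norm_ge_zero]
  by (simp add: nonneg_infsum_complete sum_ennreal)

lemma abs_summable_iff_l1_norm:
  fixes f :: "'v \<Rightarrow> 'a::real_normed_vector"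
  shows "f abs_summable_on UNIV \<longleftrightarrow> l1_norm f < \<infinity>"
proof
  assume "l1_norm f < \<infinity>"
  then obtain c where c: "c \<ge> 0" "l1_norm f = ennreal c"
    by (metis ennreal_cases infinity_ennreal_def less_irrefl)
  have "(\<Sum>i\<in>F. norm (f i)) \<le> c" if "finite F" for F
  proof -
    have "ennreal (\<Sum>i\<in>F. norm (f i)) = (\<Sum>i\<in>F. ennreal (norm (f i)))"
      by (simp add: sum_ennreal)
    also have "\<dots> \<le> l1_norm f"
      unfolding l1_norm_def using that
      by (subst nonneg_infsum_complete) (auto intro!: SUP_upper)
    finally show ?thesis using c by simp
  qed
  then show "f abs_summable_on UNIV"
    unfolding abs_summable_iff_bdd_above by (intro bdd_aboveI2[where M = c]) auto
qed (simp add: l1_norm_abs_summable)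

lemma L1_iff: "f \<in> L1 \<longleftrightarrow> f abs_summable_on UNIV"
  by (simp add: L1_def abs_summable_iff_l1_norm)

lemma bounded_kernelI:
  fixes K :: "'v \<Rightarrow> 'v \<Rightarrow> 'a::real_normed_vector"
  assumes "norm_1inf K \<le> ennreal c" "c \<ge> 0"
  shows "bounded_kernel K c"
  unfolding bounded_kernel_def
proof
  fix j
  have le: "l1_norm (\<lambda>i. K i j) \<le> ennreal c"
    using assms(1) unfolding norm_1inf_def by (simp add: SUP_le_iff)
  then have "l1_norm (\<lambda>i. K i j) < \<infinity>"
    using ennreal_less_top le_less_trans by fastforce
  then have *: "(\<lambda>i. K i j) abs_summable_on UNIV"
    by (simp add: abs_summable_iff_l1_norm)
  then show "(\<lambda>i. K i j) abs_summable_on UNIV \<and> (\<Sum>\<^sub>\<infinity>i. norm (K i j)) \<le> c"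
    using le assms(2) by (simp add: l1_norm_abs_summable)
qed

lemma bounded_1infE:
  fixes K :: "'v \<Rightarrow> 'v \<Rightarrow> 'a::real_normed_vector"
  assumes "bounded_1inf K"
  obtains c where "bounded_kernel K c" "c \<ge> 0"
proof -
  obtain c where "c \<ge> 0" "norm_1inf K = ennreal c"
    using assms unfolding bounded_1inf_def
    by (metis ennreal_cases infinity_ennreal_def less_irrefl)
  then show ?thesis using that bounded_kernelI[of K c] by simp
qed

lemma bounded_kernel_nonneg:
  assumes "bounded_kernel K c"
  shows "c \<ge> 0"
proof -
  have "0 \<le> (\<Sum>\<^sub>\<infinity>i. norm (K i undefined))" by (intro infsum_nonneg) simp
  also have "\<dots> \<le> c" using assms by (auto simp: bounded_kernel_def)
  finally show ?thesis .
qed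

lemma norm_le_infsum_norm:
  assumes "f abs_summable_on UNIV"
  shows "norm (f i) \<le> (\<Sum>\<^sub>\<infinity>i. norm (f i))"
  using finite_sum_le_infsum[OF assms, of "{i}"] by simp

text \<open>An entry is at most the sum of its column. This bound is uniform in both indices and so
  controls rows, about which column sums say nothing else.\<close>

lemma bounded_kernel_entry:
  assumes "bounded_kernel K c"
  shows "norm (K i j) \<le> c"
  using assms norm_le_infsum_norm[of "\<lambda>i. K i j" i]
  unfolding bounded_kernel_def by (meson order_trans)

text \<open>Fubini in the shape in which it is applied throughout: columns are summable with sums
  below a summable majorant \<open>g\<close>. Since \<open>infsum\<close> is 0 for families that are
  not summable, absolute summability has to come with every exchange. For
  \<open>F i j = K i j * f j\<close> the last two claims are the boundedness of the operator on
  \<open>L1\<close>.\<close>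

lemma abs_summable_columns:
  fixes F :: "'a \<Rightarrow> 'b \<Rightarrow> complex"
  assumes col: "\<And>y. y \<in> B \<Longrightarrow> (\<lambda>x. F x y) abs_summable_on A"
    and le: "\<And>y. y \<in> B \<Longrightarrow> (\<Sum>\<^sub>\<infinity>x\<in>A. norm (F x y)) \<le> g y"
    and g: "g summable_on B"
  shows "(\<lambda>(x,y). F x y) abs_summable_on A \<times> B" (is ?pair)
    and "(\<Sum>\<^sub>\<infinity>x\<in>A. \<Sum>\<^sub>\<infinity>y\<in>B. F x y) = (\<Sum>\<^sub>\<infinity>y\<in>B. \<Sum>\<^sub>\<infinity>x\<in>A. F x y)"
    and "x \<in> A \<Longrightarrow> F x abs_summable_on B"
    and "(\<lambda>x. \<Sum>\<^sub>\<infinity>y\<in>B. F x y) abs_summable_on A" (is ?rows)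
    and "(\<Sum>\<^sub>\<infinity>x\<in>A. norm (\<Sum>\<^sub>\<infinity>y\<in>B. F x y)) \<le> infsum g B"
proof -
  have gs: "(\<lambda>y. \<Sum>\<^sub>\<infinity>x\<in>A. norm (F x y)) summable_on B"
    by (rule summable_on_comparison_test[OF g le]) (auto intro: infsum_nonneg)
  then have "(\<lambda>y. \<Sum>\<^sub>\<infinity>x\<in>A. norm (F x y)) abs_summable_on B"
    by (subst (asm) summable_on_iff_abs_summable_on_real)
  then have sw: "(\<lambda>(y,x). F x y) abs_summable_on B \<times> A"
    unfolding Infinite_Sum.abs_summable_on_Sigma_iff using col by (simp add: infsum_nonneg)
  then show pair: ?pair
    by (subst (asm) summable_on_swap) (simp add: case_prod_unfold)
  show "(\<Sum>\<^sub>\<infinity>x\<in>A. \<Sum>\<^sub>\<infinity>y\<in>B. F x y) = (\<Sum>\<^sub>\<infinity>y\<in>B. \<Sum>\<^sub>\<infinity>x\<in>A. F x y)"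
    by (rule infsum_swap_banach[OF abs_summable_summable[OF pair]])
  have rows: "F x abs_summable_on B" if "x \<in> A" for x
    using pair that unfolding Infinite_Sum.abs_summable_on_Sigma_iff by auto
  show "x \<in> A \<Longrightarrow> F x abs_summable_on B" by (rule rows)
  have n2: "(\<lambda>(x,y). norm (F x y)) summable_on A \<times> B"
    using pair by (simp add: case_prod_unfold)
  have s: "(\<lambda>x. \<Sum>\<^sub>\<infinity>y\<in>B. norm (F x y)) summable_on A"
    by (rule summable_on_Sigma_banach[OF n2])
  have nle: "norm (\<Sum>\<^sub>\<infinity>y\<in>B. F x y) \<le> (\<Sum>\<^sub>\<infinity>y\<in>B. norm (F x y))" if "x \<in> A" for x
    by (rule norm_infsum_bound) (rule rows[OF that])
  show r: ?rows by (rule Infinite_Sum.abs_summable_on_comparison_test'[OF s nle])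
  have "(\<Sum>\<^sub>\<infinity>x\<in>A. norm (\<Sum>\<^sub>\<infinity>y\<in>B. F x y)) \<le> (\<Sum>\<^sub>\<infinity>x\<in>A. \<Sum>\<^sub>\<infinity>y\<in>B. norm (F x y))"
    by (rule infsum_mono[OF r s nle])
  also have "\<dots> = (\<Sum>\<^sub>\<infinity>y\<in>B. \<Sum>\<^sub>\<infinity>x\<in>A. norm (F x y))"
    by (rule infsum_swap_banach[OF n2])
  also have "\<dots> \<le> infsum g B" by (rule infsum_mono[OF gs g le])
  finally show "(\<Sum>\<^sub>\<infinity>x\<in>A. norm (\<Sum>\<^sub>\<infinity>y\<in>B. F x y)) \<le> infsum g B" .
qed

lemma infsum_nat_Suc:
  fixes f :: "nat \<Rightarrow> complex"
  assumes f: "f abs_summable_on UNIV"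
  shows "(\<lambda>n. f (Suc n)) abs_summable_on UNIV"
    and "infsum f UNIV = f 0 + (\<Sum>\<^sub>\<infinity>n. f (Suc n))"
proof -
  show s: "(\<lambda>n. f (Suc n)) abs_summable_on UNIV"
    using summable_on_subset_banach[OF f subset_UNIV[of "range Suc"]]
      summable_on_reindex[of Suc UNIV "\<lambda>n. norm (f n)"]
    by (simp add: o_def)
  have "f sums infsum f UNIV" "(\<lambda>n. f (Suc n)) sums (\<Sum>\<^sub>\<infinity>n. f (Suc n))"
    by (rule has_sum_imp_sums[OF has_sum_infsum[OF abs_summable_summable[OF f]]],
        rule has_sum_imp_sums[OF has_sum_infsum[OF abs_summable_summable[OF s]]])
  then show "infsum f UNIV = f 0 + (\<Sum>\<^sub>\<infinity>n. f (Suc n))"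
    using suminf_split_head[of f] by (auto simp: sums_iff algebra_simps)
qed

text \<open>The three hypotheses of \<open>abs_summable_columns\<close> for the family
  \<open>K i j * f j\<close>, with majorant \<open>c * norm (f j)\<close>.\<close>

lemma weight_op_columns:
  assumes "bounded_kernel K c" "f \<in> L1"
  shows "(\<lambda>i. K i j * f j) abs_summable_on UNIV"
    and "(\<Sum>\<^sub>\<infinity>i. norm (K i j * f j)) \<le> c * norm (f j)"
    and "(\<lambda>j. c * norm (f j)) summable_on UNIV"
proof -
  have K: "(\<lambda>i. K i j) abs_summable_on UNIV" "(\<Sum>\<^sub>\<infinity>i. norm (K i j)) \<le> c"
    using assms(1) by (auto simp: bounded_kernel_def)
  show "(\<lambda>i. K i j * f j) abs_summable_on UNIV"
    unfolding norm_mult using K(1) by (rule summable_on_cmult_left)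
  show "(\<Sum>\<^sub>\<infinity>i. norm (K i j * f j)) \<le> c * norm (f j)"
    unfolding norm_mult infsum_cmult_left' using K(2) by (simp add: mult_right_mono)
  show "(\<lambda>j. c * norm (f j)) summable_on UNIV"
    using assms(2) by (intro summable_on_cmult_right) (simp add: L1_iff)
qed

lemma weight_op_L1:
  assumes "bounded_kernel K c" "f \<in> L1"
  shows "weight_op K f \<in> L1"
    and "(\<Sum>\<^sub>\<infinity>i. norm (weight_op K f i)) \<le> c * (\<Sum>\<^sub>\<infinity>i. norm (f i))"
    and "(\<lambda>j. K i j * f j) abs_summable_on UNIV"
  using abs_summable_columns(3-5)[OF weight_op_columns[OF assms]]
  by (simp_all add: weight_op_def[abs_def] L1_iff infsum_cmult_right')

text \<open>Associativity of matrix products. With the row \<open>i\<close> fixed, \<open>K\<close>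
  contributes its entry bound and \<open>L\<close> its column sums, so the double sum over
  \<open>z\<close> and \<open>j\<close> has the majorant
  \<open>c * (d * norm (f j))\<close>.\<close>

lemma weight_op_comp:
  assumes K: "bounded_kernel K c" and L: "bounded_kernel L d" and f: "f \<in> L1"
  shows "weight_op K (weight_op L f) = weight_op (\<lambda>i j. weight_op K (\<lambda>z. L z j) i) f"
proof
  fix i
  have col: "(\<lambda>z. K i z * (L z j * f j)) abs_summable_on UNIV"
    and le: "(\<Sum>\<^sub>\<infinity>z. norm (K i z * (L z j * f j))) \<le> c * (d * norm (f j))" for j
  proof -
    have s: "(\<lambda>z. c * norm (L z j * f j)) summable_on UNIV"
      by (intro summable_on_cmult_right weight_op_columns(1)[OF L f])
    have le: "norm (K i z * (L z j * f j)) \<le> c * norm (L z j * f j)" for z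
      unfolding norm_mult[of "K i z"]
      by (intro mult_right_mono bounded_kernel_entry[OF K]) simp
    show 1: "(\<lambda>z. K i z * (L z j * f j)) abs_summable_on UNIV"
      by (rule Infinite_Sum.abs_summable_on_comparison_test'[OF s le])
    have "(\<Sum>\<^sub>\<infinity>z. norm (K i z * (L z j * f j))) \<le> (\<Sum>\<^sub>\<infinity>z. c * norm (L z j * f j))"
      by (rule infsum_mono[OF 1 s le])
    also have "\<dots> \<le> c * (d * norm (f j))"
      unfolding infsum_cmult_right' using weight_op_columns(2)[OF L f, of j]
      by (intro mult_left_mono bounded_kernel_nonneg[OF K])
    finally show "(\<Sum>\<^sub>\<infinity>z. norm (K i z * (L z j * f j))) \<le> c * (d * norm (f j))" .
  qed
  have "(\<lambda>j. c * (d * norm (f j))) summable_on UNIV"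
    by (intro summable_on_cmult_right weight_op_columns(3)[OF L f])
  from abs_summable_columns(2)[OF col le this]
  have "(\<Sum>\<^sub>\<infinity>z. \<Sum>\<^sub>\<infinity>j. K i z * (L z j * f j)) = (\<Sum>\<^sub>\<infinity>j. \<Sum>\<^sub>\<infinity>z. K i z * L z j * f j)"
    by (simp add: mult.assoc)
  then show "weight_op K (weight_op L f) i = weight_op (\<lambda>i j. weight_op K (\<lambda>z. L z j) i) f i"
    unfolding weight_op_def infsum_cmult_right' infsum_cmult_left' .
qed

lemma bounded_kernel_comp:
  assumes K: "bounded_kernel K c" and L: "bounded_kernel L d"
  shows "bounded_kernel (\<lambda>i j. weight_op K (\<lambda>z. L z j) i) (c * d)"
  unfolding bounded_kernel_def
proof
  fix j
  have "(\<lambda>z. L z j) \<in> L1" and d: "(\<Sum>\<^sub>\<infinity>z. norm (L z j)) \<le> d"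
    using L by (auto simp: bounded_kernel_def L1_iff)
  note W = weight_op_L1(1,2)[OF K this(1)]
  show "weight_op K (\<lambda>z. L z j) abs_summable_on UNIV \<and>
      (\<Sum>\<^sub>\<infinity>i. norm (weight_op K (\<lambda>z. L z j) i)) \<le> c * d"
    using W order_trans[OF W(2) mult_left_mono[OF d bounded_kernel_nonneg[OF K]]]
    by (simp add: L1_iff)
qed

section \<open>Linearity and cutoff rules\<close>

lemma L1_add: "f \<in> L1 \<Longrightarrow> g \<in> L1 \<Longrightarrow> (\<lambda>i. f i + g i) \<in> L1"
  unfolding L1_iff
  by (rule Infinite_Sum.abs_summable_on_comparison_test'[where g = "\<lambda>i. norm (f i) + norm (g i)"])
     (auto intro: summable_on_add norm_triangle_ineq)

lemma L1_cmult: "f \<in> L1 \<Longrightarrow> (\<lambda>i. c * f i) \<in> L1"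
  unfolding L1_iff by (simp add: norm_mult summable_on_cmult_right)

lemma L1_diff: "f \<in> L1 \<Longrightarrow> g \<in> L1 \<Longrightarrow> (\<lambda>i. f i - g i) \<in> L1"
  using L1_add[of f "\<lambda>i. -1 * g i"] L1_cmult[of g "-1"] by simp

lemma L1_trunc_on: "f \<in> L1 \<Longrightarrow> trunc_on A f \<in> L1"
  unfolding L1_iff by (rule Infinite_Sum.abs_summable_on_comparison_test) (auto simp: trunc_on_def)

lemma infsum_norm_trunc_on_le:
  assumes "f \<in> L1"
  shows "(\<Sum>\<^sub>\<infinity>i. norm (trunc_on A f i)) \<le> (\<Sum>\<^sub>\<infinity>i. norm (f i))"
  using assms L1_trunc_on[OF assms, of A] unfolding L1_iff
  by (intro infsum_mono) (auto simp: trunc_on_def)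

lemma infsum_norm_add_le:
  assumes "f \<in> L1" "g \<in> L1"
  shows "(\<Sum>\<^sub>\<infinity>i. norm (f i + g i)) \<le> (\<Sum>\<^sub>\<infinity>i. norm (f i)) + (\<Sum>\<^sub>\<infinity>i. norm (g i))"
  using assms L1_add[OF assms] unfolding L1_iff
  by (subst infsum_add[symmetric]) (auto intro!: infsum_mono summable_on_add norm_triangle_ineq)

text \<open>Applied to vectors of C^S: their value \<open>undefined\<close> off \<open>S\<close> is
  replaced by 0, which embeds them into \<open>L1\<close>.\<close>

lemma L1_finite_support: "finite A \<Longrightarrow> trunc_on A f \<in> L1"
  unfolding L1_iff trunc_on_def
  by (rule finite_nonzero_values_imp_summable_on) (erule rev_finite_subset, auto)

lemma weight_op_add:
  assumes "bounded_kernel K c" "f \<in> L1" "g \<in> L1"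
  shows "weight_op K (\<lambda>i. f i + g i) = (\<lambda>i. weight_op K f i + weight_op K g i)"
  unfolding weight_op_def distrib_left
  using abs_summable_summable[OF weight_op_L1(3)[OF assms(1,2)]]
    abs_summable_summable[OF weight_op_L1(3)[OF assms(1,3)]]
  by (intro ext infsum_add)

lemma weight_op_cmult: "weight_op K (\<lambda>i. a * f i) = (\<lambda>i. a * weight_op K f i)"
  unfolding weight_op_def by (simp add: mult.left_commute infsum_cmult_right')

lemma weight_op_diff:
  assumes "bounded_kernel K c" "f \<in> L1" "g \<in> L1"
  shows "weight_op K (\<lambda>i. f i - g i) = (\<lambda>i. weight_op K f i - weight_op K g i)"
  using weight_op_add[OF assms(1,2) L1_cmult[OF assms(3), of "-1"]] weight_op_cmult[of K "-1" g]
  by simp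

lemma infsum_diff:
  fixes f g :: "'a \<Rightarrow> complex"
  assumes "f summable_on A" "g summable_on A"
  shows "(\<Sum>\<^sub>\<infinity>x\<in>A. f x - g x) = infsum f A - infsum g A"
  using infsum_add[OF assms(1) summable_on_uminus[THEN iffD2, OF assms(2)]]
  by (simp add: infsum_uminus)

lemma weight_op_kernel_diff:
  assumes "bounded_kernel K c" "bounded_kernel L d" "f \<in> L1"
  shows "weight_op (\<lambda>i j. K i j - L i j) f = (\<lambda>i. weight_op K f i - weight_op L f i)"
  unfolding weight_op_def left_diff_distrib
  using abs_summable_summable[OF weight_op_L1(3)[OF assms(1,3)]]
    abs_summable_summable[OF weight_op_L1(3)[OF assms(2,3)]]
  by (intro ext infsum_diff)

lemma weight_op_kernel_cmult: "weight_op (\<lambda>i j. a * K i j) f = (\<lambda>i. a * weight_op K f i)"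
  unfolding weight_op_def by (simp add: mult.assoc infsum_cmult_right')

lemma bounded_kernel_columnI:
  assumes "\<And>j. (\<lambda>i. K i j) \<in> L1" "\<And>j. (\<Sum>\<^sub>\<infinity>i. norm (K i j)) \<le> c"
  shows "bounded_kernel K c"
  using assms by (auto simp: bounded_kernel_def L1_iff)

lemma bounded_kernel_trunc_on:
  assumes "bounded_kernel K c"
  shows "bounded_kernel (\<lambda>i j. trunc_on A (\<lambda>z. K z j) i) c"
proof (rule bounded_kernel_columnI)
  fix j
  have "(\<lambda>z. K z j) \<in> L1" "(\<Sum>\<^sub>\<infinity>i. norm (K i j)) \<le> c"
    using assms by (auto simp: bounded_kernel_def L1_iff)
  then show "trunc_on A (\<lambda>z. K z j) \<in> L1" "(\<Sum>\<^sub>\<infinity>i. norm (trunc_on A (\<lambda>z. K z j) i)) \<le> c"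
    using L1_trunc_on infsum_norm_trunc_on_le order_trans by blast+
qed

text \<open>Moves a cutoff from the result of an operator into its kernel, so that
  \<open>weight_op_comp\<close> also covers products with a cutoff between the two factors.\<close>

lemma weight_op_trunc_on_kernel: "weight_op (\<lambda>i j. trunc_on A (\<lambda>z. K z j) i) f = trunc_on A (weight_op K f)"
  by (auto simp: weight_op_def trunc_on_def)

section \<open>The reduced kernel\<close>

text \<open>The index set of \<open>tau w S (Suc n)\<close>; indexing by the length itself avoids
  the subtraction \<open>n - 1\<close>.\<close>

definition off_lists :: "'v set \<Rightarrow> nat \<Rightarrow> 'v list set" where
  "off_lists S n = {zs. length zs = n \<and> set zs \<subseteq> - S}"

lemma tau_Suc: "tau w S (Suc n) i j = (\<Sum>\<^sub>\<infinity>zs\<in>off_lists S n. path_weight w i zs j)"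
  by (simp add: tau_def off_lists_def)

lemma path_weight_Cons: "path_weight w i (z # zs) j = w i z * path_weight w z zs j"
  by (simp add: path_weight_def)

lemma path_weight_snoc: "path_weight w i (zs @ [z]) j = path_weight w i zs z * w z j"
  by (induction zs arbitrary: i) (simp_all add: path_weight_def mult.assoc)

lemma bij_betw_Cons_off_lists:
  "bij_betw (\<lambda>(z, zs). z # zs) ((- S) \<times> off_lists S n) (off_lists S (Suc n))"
  unfolding bij_betw_def off_lists_def by (force simp: inj_on_def length_Suc_conv)

lemma bij_betw_snoc_off_lists:
  "bij_betw (\<lambda>(zs, z). zs @ [z]) (off_lists S n \<times> (- S)) (off_lists S (Suc n))"
  unfolding bij_betw_def off_lists_def by (force simp: inj_on_def length_Suc_conv_rev)

lemma off_lists_0: "off_lists S 0 = {[]}"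
  by (auto simp: off_lists_def)

lemma tau_1: "tau w S (Suc 0) = w"
  by (intro ext) (simp add: tau_Suc off_lists_0 path_weight_def)

text \<open>The induction lengthens a path at its end: summing \<open>w z j\<close> over
  \<open>z\<close> is a column sum and costs a factor \<open>c\<close>, whereas lengthening at the
  start would call for row sums. The base case is the entry bound, which explains the exponent
  \<open>Suc n\<close>.\<close>

lemma path_weight_abs_summable:
  assumes w: "bounded_kernel w c"
  shows "(\<lambda>zs. path_weight w i zs j) abs_summable_on off_lists S n \<and>
         (\<Sum>\<^sub>\<infinity>zs\<in>off_lists S n. norm (path_weight w i zs j)) \<le> c ^ Suc n"
proof (induction n arbitrary: j)
  case 0
  then show ?case using bounded_kernel_entry[OF w] by (simp add: off_lists_0 path_weight_def)
next
  case (Suc n)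
  let ?f = "\<lambda>zs z. path_weight w i zs z * w z j"
  have col: "(\<lambda>zs. ?f zs z) abs_summable_on off_lists S n"
    and le: "(\<Sum>\<^sub>\<infinity>zs\<in>off_lists S n. norm (?f zs z)) \<le> c ^ Suc n * norm (w z j)" for z
    unfolding norm_mult infsum_cmult_left'
    using Suc.IH[of z] by (auto intro: summable_on_cmult_left mult_right_mono)
  have ws: "(\<lambda>z. w z j) abs_summable_on UNIV" and wle: "(\<Sum>\<^sub>\<infinity>z. norm (w z j)) \<le> c"
    using w by (auto simp: bounded_kernel_def)
  have ws': "(\<lambda>z. w z j) abs_summable_on - S"
    by (rule summable_on_subset_banach[OF ws]) simp
  have g: "(\<lambda>z. c ^ Suc n * norm (w z j)) summable_on - S"
    by (rule summable_on_cmult_right[OF ws'])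
  have pair: "(\<lambda>(zs, z). ?f zs z) abs_summable_on off_lists S n \<times> (- S)"
    by (rule abs_summable_columns(1)[OF col le g])
  have 1: "(\<lambda>zs. path_weight w i zs j) abs_summable_on off_lists S (Suc n)"
    using pair
    by (subst summable_on_reindex_bij_betw[OF bij_betw_snoc_off_lists, symmetric])
       (simp add: case_prod_unfold path_weight_snoc)
  have "(\<Sum>\<^sub>\<infinity>zs\<in>off_lists S (Suc n). norm (path_weight w i zs j))
      = (\<Sum>\<^sub>\<infinity>(zs, z)\<in>off_lists S n \<times> (- S). norm (?f zs z))"
    by (subst infsum_reindex_bij_betw[OF bij_betw_snoc_off_lists, symmetric])
       (simp add: case_prod_unfold path_weight_snoc)
  also have "\<dots> = (\<Sum>\<^sub>\<infinity>zs\<in>off_lists S n. \<Sum>\<^sub>\<infinity>z\<in>- S. norm (?f zs z))"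
    using pair by (subst infsum_Sigma'_banach) (simp_all add: case_prod_unfold)
  also have "\<dots> = (\<Sum>\<^sub>\<infinity>z\<in>- S. \<Sum>\<^sub>\<infinity>zs\<in>off_lists S n. norm (?f zs z))"
    using pair by (intro infsum_swap_banach) (simp add: case_prod_unfold)
  also have "\<dots> \<le> (\<Sum>\<^sub>\<infinity>z\<in>- S. c ^ Suc n * norm (w z j))"
    by (rule infsum_mono[OF _ g le])
       (rule summable_on_comparison_test[OF g le], auto intro: infsum_nonneg)
  also have "\<dots> = c ^ Suc n * (\<Sum>\<^sub>\<infinity>z\<in>- S. norm (w z j))"
    by (rule infsum_cmult_right')
  also have "\<dots> \<le> c ^ Suc n * c"
    using infsum_mono2[OF ws' ws] wle bounded_kernel_nonneg[OF w]
    by (intro mult_left_mono) auto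
  finally show ?case using 1 by (simp add: mult.commute)
qed

text \<open>Splits every path at its first intermediate vertex. This recursion becomes the equation
  for TCQ.\<close>

lemma tau_Suc_Suc_first:
  assumes w: "bounded_kernel w c"
  shows "tau w S (Suc (Suc n)) i j = weight_op w (trunc_on (- S) (\<lambda>z. tau w S (Suc n) z j)) i"
proof -
  have "(\<lambda>(z, zs). path_weight w i (z # zs) j) summable_on (- S) \<times> off_lists S n"
    using abs_summable_summable[OF conjunct1[OF path_weight_abs_summable[OF w, where n = "Suc n"]]]
    by (subst (asm) summable_on_reindex_bij_betw[OF bij_betw_Cons_off_lists, symmetric])
       (simp add: case_prod_unfold)
  then have "tau w S (Suc (Suc n)) i j
      = (\<Sum>\<^sub>\<infinity>z\<in>- S. \<Sum>\<^sub>\<infinity>zs\<in>off_lists S n. path_weight w i (z # zs) j)"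
    unfolding tau_Suc
    by (subst infsum_reindex_bij_betw[OF bij_betw_Cons_off_lists, symmetric])
       (simp add: case_prod_unfold infsum_Sigma'_banach)
  also have "\<dots> = (\<Sum>\<^sub>\<infinity>z\<in>- S. w i z * tau w S (Suc n) z j)"
    unfolding path_weight_Cons tau_Suc infsum_cmult_right' ..
  also have "\<dots> = weight_op w (trunc_on (- S) (\<lambda>z. tau w S (Suc n) z j)) i"
    unfolding weight_op_def by (rule infsum_cong_neutral) (auto simp: trunc_on_def)
  finally show ?thesis .
qed

text \<open>Splits every path at its last intermediate vertex, which becomes the equation for QCT.
  The two sums are swapped so that, for a fixed last vertex, the initial segments add up to a value
  of \<open>tau\<close>.\<close>

lemma tau_Suc_Suc_last:
  assumes w: "bounded_kernel w c"
  shows "tau w S (Suc (Suc n)) i j = weight_op (tau w S (Suc n)) (trunc_on (- S) (\<lambda>z. w z j)) i"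
proof -
  have s: "(\<lambda>(zs, z). path_weight w i (zs @ [z]) j) summable_on off_lists S n \<times> (- S)"
    using abs_summable_summable[OF conjunct1[OF path_weight_abs_summable[OF w, where n = "Suc n"]]]
    by (subst (asm) summable_on_reindex_bij_betw[OF bij_betw_snoc_off_lists, symmetric])
       (simp add: case_prod_unfold)
  then have "tau w S (Suc (Suc n)) i j
      = (\<Sum>\<^sub>\<infinity>zs\<in>off_lists S n. \<Sum>\<^sub>\<infinity>z\<in>- S. path_weight w i (zs @ [z]) j)"
    unfolding tau_Suc
    by (subst infsum_reindex_bij_betw[OF bij_betw_snoc_off_lists, symmetric])
       (simp add: case_prod_unfold infsum_Sigma'_banach)
  also have "\<dots> = (\<Sum>\<^sub>\<infinity>z\<in>- S. \<Sum>\<^sub>\<infinity>zs\<in>off_lists S n. path_weight w i (zs @ [z]) j)"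
    by (rule infsum_swap_banach[OF s])
  also have "\<dots> = (\<Sum>\<^sub>\<infinity>z\<in>- S. tau w S (Suc n) i z * w z j)"
    unfolding path_weight_snoc tau_Suc infsum_cmult_left' ..
  also have "\<dots> = weight_op (tau w S (Suc n)) (trunc_on (- S) (\<lambda>z. w z j)) i"
    unfolding weight_op_def by (rule infsum_cong_neutral) (auto simp: trunc_on_def)
  finally show ?thesis .
qed

text \<open>Eventually \<open>t n\<close> is at most \<open>(r / 2) ^ n\<close>, so the quotients
  are dominated by a geometric series of ratio 1/2. The shift matches paths of n + 1 edges with the
  factor \<open>1 / l ^ n\<close> and leaves one extra factor \<open>r / 2\<close>.\<close>

lemma summable_superexponential:
  assumes t: "\<And>n. t n > 0" and lim: "filterlim (\<lambda>n. ln (t n) / real n) at_bot sequentially"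
    and r: "r > 0"
  shows "summable (\<lambda>n. t (Suc n) / r ^ n)"
proof (rule summable_comparison_test_ev)
  have "\<forall>\<^sub>F n in sequentially. ln (t n) / real n \<le> ln (r / 2)"
    using lim unfolding filterlim_at_bot by blast
  then have "\<forall>\<^sub>F n in sequentially. ln (t (Suc n)) / real (Suc n) \<le> ln (r / 2)"
    by (rule eventually_sequentially_Suc[THEN iffD2])
  then show "\<forall>\<^sub>F n in sequentially. norm (t (Suc n) / r ^ n) \<le> r / 2 * (1 / 2) ^ n"
  proof eventually_elim
    case (elim n)
    then have "ln (t (Suc n)) \<le> real (Suc n) * ln (r / 2)"
      by (simp add: divide_le_eq mult.commute del: of_nat_Suc)
    also have "\<dots> = ln ((r / 2) ^ Suc n)" using r by (subst ln_realpow) auto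
    finally have "t (Suc n) \<le> (r / 2) ^ Suc n" using t[of "Suc n"] r by simp
    then have "t (Suc n) / r ^ n \<le> (r / 2) ^ Suc n / r ^ n"
      using r by (intro divide_right_mono) auto
    also have "\<dots> = r / 2 * (1 / 2) ^ n" using r by (simp add: power_divide field_simps)
    finally show ?case using t[of "Suc n"] r by (simp add: less_imp_le)
  qed
  show "summable (\<lambda>n. r / 2 * (1 / 2) ^ n :: real)"
    by (intro summable_mult summable_geometric) simp
qed

text \<open>The two equations are $Q = w + \lambda^{-1} w\, 1_{S^c} Q = w + \lambda^{-1} Q\, 1_{S^c} w$
  in terms of matrix products.\<close>

locale reduced_kernel =
  fixes w Q :: "'v \<Rightarrow> 'v \<Rightarrow> complex" and S :: "'v set" and l :: complex and c C :: real
  assumes w: "bounded_kernel w c" and Q: "bounded_kernel Q C" and l: "l \<noteq> 0"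
    and first: "weight_op w (trunc_on (- S) (\<lambda>z. Q z j)) i = l * (Q i j - w i j)"
    and last: "weight_op Q (trunc_on (- S) (\<lambda>z. w z j)) i = l * (Q i j - w i j)"

text \<open>The n-th term of the series is dominated by \<open>s n * N i j\<close>, with
  \<open>s\<close> summable and \<open>N\<close> column-summable, so sums over \<open>n\<close> and
  over vertices may be exchanged. Termwise, each of the two path splittings raises the index by one,
  which accounts for the factor \<open>l\<close> and the missing term \<open>w\<close> in the two
  equations.\<close>

lemma reduced_kernel_reduced_matrix:
  assumes w: "bounded_kernel w c" and A: "structural_A w S" and l: "l \<noteq> 0"
  shows "\<exists>C. reduced_kernel w (reduced_matrix w S l) S l c C"
proof -
  obtain t M where t: "\<And>n. t n > 0" "filterlim (\<lambda>n. ln (t n) / real n) at_bot sequentially"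
    and M: "\<And>i j. M i j \<ge> 0" "bounded_1inf M"
    and tau: "\<And>i j n. n \<ge> 2 \<Longrightarrow> norm (tau w S n i j) \<le> t n * M i j"
    using A unfolding structural_A_def by blast
  obtain m where m: "bounded_kernel M m" by (rule bounded_1infE[OF M(2)])
  define q where "q n i j = tau w S (Suc n) i j / l ^ n" for n i j
  \<comment> \<open>Type A bounds only path lengths from 2 on. The term of length 1 is
    \<open>w\<close> itself; it gets coefficient 1 and is absorbed into \<open>N\<close>.\<close>
  define s where "s n = (if n = 0 then 1 else t (Suc n) / norm l ^ n)" for n :: nat
  define N where "N i j = norm (w i j) + M i j" for i j
  have s0: "s n \<ge> 0" for n using t(1)[of "Suc n"] by (simp add: s_def less_imp_le)
  have N0: "N i j \<ge> 0" for i j using M(1) by (simp add: N_def)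
  have s: "s summable_on UNIV"
  proof (rule summable_nonneg_imp_summable_on)
    have "summable (\<lambda>n. t (Suc n) / norm l ^ n)" using t l by (intro summable_superexponential) auto
    then have "summable (\<lambda>n. s (Suc n))"
      by (subst (asm) summable_Suc_iff[symmetric]) (simp add: s_def)
    then show "summable s" by (simp only: summable_Suc_iff)
  qed (rule s0)
  have N: "bounded_kernel N (c + m)"
    unfolding bounded_kernel_def
  proof
    fix j
    have 1: "(\<lambda>i. norm (w i j)) summable_on UNIV" "(\<Sum>\<^sub>\<infinity>i. norm (w i j)) \<le> c"
      using w by (auto simp: bounded_kernel_def)
    have 2: "(\<lambda>i. M i j) summable_on UNIV" "(\<Sum>\<^sub>\<infinity>i. M i j) \<le> m"
      using m M(1) by (auto simp: bounded_kernel_def)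
    have "(\<lambda>i. N i j) summable_on UNIV" "(\<Sum>\<^sub>\<infinity>i. N i j) \<le> c + m"
      using 1 2 by (auto simp: N_def infsum_add intro: summable_on_add)
    then show "(\<lambda>i. N i j) abs_summable_on UNIV \<and> (\<Sum>\<^sub>\<infinity>i. norm (N i j)) \<le> c + m"
      using N0 by simp
  qed
  have Nm: "N i j \<le> c + m" for i j using bounded_kernel_entry[OF N, of i j] by simp
  have qN: "norm (q n i j) \<le> s n * N i j" for n i j
  proof (cases n)
    case 0
    then show ?thesis using M(1) by (simp add: q_def s_def N_def tau_1)
  next
    case (Suc k)
    have "norm (q n i j) \<le> t (Suc n) * M i j / norm l ^ n"
      unfolding q_def norm_divide norm_power using tau[of "Suc n" i j] Suc
      by (intro divide_right_mono) auto
    also have "\<dots> = s n * M i j" using Suc by (simp add: s_def)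
    also have "\<dots> \<le> s n * N i j" using s0 by (intro mult_left_mono) (auto simp: N_def)
    finally show ?thesis .
  qed
  have q_sum: "(\<lambda>n. q n i j) abs_summable_on UNIV" for i j
    by (rule Infinite_Sum.abs_summable_on_comparison_test'[OF summable_on_cmult_left[OF s, of "N i j"]]) (rule qN)
  \<comment> \<open>Absolute summability identifies the \<open>suminf\<close> of the definition with
    an \<open>infsum\<close>. Its n-th term \<open>tau w S (n + 2) i j / l ^ (n + 1)\<close> is
    \<open>q (Suc n) i j\<close>.\<close>
  have Q_Suc: "reduced_matrix w S l i j = w i j + (\<Sum>\<^sub>\<infinity>n. q (Suc n) i j)" for i j
    using has_sum_imp_sums[OF has_sum_infsum[OF abs_summable_summable[OF
          infsum_nat_Suc(1)[OF q_sum[of i j]]]]]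
    by (simp add: reduced_matrix_def sums_iff q_def)
  then have Q_eq: "reduced_matrix w S l i j = (\<Sum>\<^sub>\<infinity>n. q n i j)" for i j
    using infsum_nat_Suc(2)[OF q_sum, of i j] by (simp add: q_def[of 0] tau_1)
  have col: "(\<lambda>i. q n i j) abs_summable_on UNIV"
    and le: "(\<Sum>\<^sub>\<infinity>i. norm (q n i j)) \<le> s n * (c + m)" for n j
  proof -
    have Nj: "(\<lambda>i. N i j) summable_on UNIV" "(\<Sum>\<^sub>\<infinity>i. N i j) \<le> c + m"
      using N N0 by (auto simp: bounded_kernel_def)
    have sN: "(\<lambda>i. s n * N i j) summable_on UNIV" by (rule summable_on_cmult_right[OF Nj(1)])
    show 1: "(\<lambda>i. q n i j) abs_summable_on UNIV"
      by (rule Infinite_Sum.abs_summable_on_comparison_test'[OF sN qN])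
    have "(\<Sum>\<^sub>\<infinity>i. norm (q n i j)) \<le> s n * (\<Sum>\<^sub>\<infinity>i. N i j)"
      unfolding infsum_cmult_right'[symmetric] by (rule infsum_mono[OF 1 sN qN])
    also have "\<dots> \<le> s n * (c + m)" using Nj(2) s0 by (rule mult_left_mono)
    finally show "(\<Sum>\<^sub>\<infinity>i. norm (q n i j)) \<le> s n * (c + m)" .
  qed
  have scm: "(\<lambda>n. s n * (c + m)) summable_on UNIV" by (rule summable_on_cmult_left[OF s])
  have Qb: "bounded_kernel (reduced_matrix w S l) (infsum (\<lambda>n. s n * (c + m)) UNIV)"
    unfolding bounded_kernel_def Q_eq
    using abs_summable_columns(4,5)[where F = "\<lambda>i n. q n i j" for j, OF col le scm] by blast
  have split: "(\<Sum>\<^sub>\<infinity>n. l * q (Suc n) i j) = l * (reduced_matrix w S l i j - w i j)" for i j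
    by (simp add: infsum_cmult_right' Q_Suc)
  have w_le: "norm (w i z) \<le> c" for i z by (rule bounded_kernel_entry[OF w])
  have c0: "c \<ge> 0" by (rule bounded_kernel_nonneg[OF w])
  show ?thesis
  proof (intro exI, unfold_locales)
    show "bounded_kernel w c" by (rule w)
    show "bounded_kernel (reduced_matrix w S l) (infsum (\<lambda>n. s n * (c + m)) UNIV)" by (rule Qb)
    show "l \<noteq> 0" by (rule l)
  next
    fix i j
    \<comment> \<open>Here the column sum over \<open>z\<close> is that of \<open>q n\<close>, while
      \<open>w\<close> contributes its entry bound \<open>c\<close>.\<close>
    let ?F = "\<lambda>z n. w i z * trunc_on (- S) (\<lambda>z. q n z j) z"
    have Fle: "norm (?F z n) \<le> c * norm (q n z j)" for z n
      using w_le[of i z] c0 by (auto simp: trunc_on_def norm_mult intro: mult_right_mono)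
    have qs: "(\<lambda>z. c * norm (q n z j)) summable_on UNIV" for n
      by (rule summable_on_cmult_right[OF col])
    have Fcol: "(\<lambda>z. ?F z n) abs_summable_on UNIV" for n
      by (rule Infinite_Sum.abs_summable_on_comparison_test'[OF qs Fle])
    have Fsum: "(\<Sum>\<^sub>\<infinity>z. norm (?F z n)) \<le> c * (s n * (c + m))" for n
    proof -
      have "(\<Sum>\<^sub>\<infinity>z. norm (?F z n)) \<le> (\<Sum>\<^sub>\<infinity>z. c * norm (q n z j))"
        by (rule infsum_mono[OF Fcol qs Fle])
      also have "\<dots> \<le> c * (s n * (c + m))"
        unfolding infsum_cmult_right' by (rule mult_left_mono[OF le c0])
      finally show ?thesis .
    qed
    have "(\<Sum>\<^sub>\<infinity>z. \<Sum>\<^sub>\<infinity>n. ?F z n) = (\<Sum>\<^sub>\<infinity>n. \<Sum>\<^sub>\<infinity>z. ?F z n)"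
      by (rule abs_summable_columns(2)[OF Fcol Fsum summable_on_cmult_right[OF scm]])
    moreover have "(\<Sum>\<^sub>\<infinity>n. ?F z n) = w i z * trunc_on (- S) (\<lambda>z. reduced_matrix w S l z j) z" for z
      by (simp add: trunc_on_def Q_eq infsum_cmult_right')
    moreover have "(\<Sum>\<^sub>\<infinity>z. ?F z n) = l * q (Suc n) i j" for n
    proof -
      have "?F z n = (w i z * trunc_on (- S) (\<lambda>z. tau w S (Suc n) z j) z) * inverse (l ^ n)" for z
        by (simp add: trunc_on_def q_def divide_inverse)
      then have "(\<Sum>\<^sub>\<infinity>z. ?F z n) = tau w S (Suc (Suc n)) i j * inverse (l ^ n)"
        by (simp only: infsum_cmult_left' tau_Suc_Suc_first[OF w] weight_op_def)
      then show ?thesis using l by (simp add: q_def field_simps)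
    qed
    ultimately show "weight_op w (trunc_on (- S) (\<lambda>z. reduced_matrix w S l z j)) i
        = l * (reduced_matrix w S l i j - w i j)"
      by (simp add: weight_op_def split)
  next
    fix i j
    \<comment> \<open>The roles are exchanged: \<open>w\<close> contributes the column sum over
      \<open>z\<close> and \<open>q n\<close> the entry bound \<open>s n * (c + m)\<close>.\<close>
    let ?F = "\<lambda>z n. q n i z * trunc_on (- S) (\<lambda>z. w z j) z"
    have "norm (q n i z) \<le> s n * (c + m)" for z n
      using qN[of n i z] mult_left_mono[OF Nm s0] order_trans by blast
    then have Fle: "norm (?F z n) \<le> s n * (c + m) * norm (w z j)" for z n
      using s0 bounded_kernel_nonneg[OF N]
      by (auto simp: trunc_on_def norm_mult intro: mult_right_mono)
    have wj: "(\<lambda>z. w z j) abs_summable_on UNIV" "(\<Sum>\<^sub>\<infinity>z. norm (w z j)) \<le> c"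
      using w by (auto simp: bounded_kernel_def)
    have ws: "(\<lambda>z. s n * (c + m) * norm (w z j)) summable_on UNIV" for n
      by (rule summable_on_cmult_right[OF wj(1)])
    have Fcol: "(\<lambda>z. ?F z n) abs_summable_on UNIV" for n
      by (rule Infinite_Sum.abs_summable_on_comparison_test'[OF ws Fle])
    have Fsum: "(\<Sum>\<^sub>\<infinity>z. norm (?F z n)) \<le> s n * (c + m) * c" for n
    proof -
      have "(\<Sum>\<^sub>\<infinity>z. norm (?F z n)) \<le> (\<Sum>\<^sub>\<infinity>z. s n * (c + m) * norm (w z j))"
        by (rule infsum_mono[OF Fcol ws Fle])
      also have "\<dots> \<le> s n * (c + m) * c"
        unfolding infsum_cmult_right'
        using bounded_kernel_nonneg[OF N] s0 by (intro mult_left_mono[OF wj(2)]) simp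
      finally show ?thesis .
    qed
    have "(\<Sum>\<^sub>\<infinity>z. \<Sum>\<^sub>\<infinity>n. ?F z n) = (\<Sum>\<^sub>\<infinity>n. \<Sum>\<^sub>\<infinity>z. ?F z n)"
      by (rule abs_summable_columns(2)[OF Fcol Fsum summable_on_cmult_left[OF scm]])
    moreover have "(\<Sum>\<^sub>\<infinity>n. ?F z n) = reduced_matrix w S l i z * trunc_on (- S) (\<lambda>z. w z j) z" for z
      by (simp add: Q_eq infsum_cmult_left')
    moreover have "(\<Sum>\<^sub>\<infinity>z. ?F z n) = l * q (Suc n) i j" for n
    proof -
      have "?F z n = inverse (l ^ n) * (tau w S (Suc n) i z * trunc_on (- S) (\<lambda>z. w z j) z)" for z
        by (simp add: q_def divide_inverse)
      then have "(\<Sum>\<^sub>\<infinity>z. ?F z n) = inverse (l ^ n) * tau w S (Suc (Suc n)) i j"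
        by (simp only: infsum_cmult_right' tau_Suc_Suc_last[OF w] weight_op_def)
      then show ?thesis using l by (simp add: q_def field_simps)
    qed
    ultimately show "weight_op (reduced_matrix w S l) (trunc_on (- S) (\<lambda>z. w z j)) i
        = l * (reduced_matrix w S l i j - w i j)"
      by (simp add: weight_op_def split)
  qed
qed

section \<open>Schur complement identities\<close>

lemma trunc_on_decomp: "f = (\<lambda>i. trunc_on S f i + trunc_on (- S) f i)"
  by (auto simp: trunc_on_def)

lemma trunc_on_eqI: "(\<And>i. i \<in> S \<Longrightarrow> f i = g i) \<Longrightarrow> trunc_on S f = trunc_on S g"
  by (auto simp: trunc_on_def)

lemma weight_op_trunc_on_finite:
  assumes "finite S"
  shows "weight_op K (trunc_on S v) i = (\<Sum>j\<in>S. K i j * v j)"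
proof -
  have "weight_op K (trunc_on S v) i = (\<Sum>\<^sub>\<infinity>j\<in>S. K i j * v j)"
    unfolding weight_op_def by (rule infsum_cong_neutral) (auto simp: trunc_on_def)
  then show ?thesis using assms by simp
qed

context reduced_kernel
begin

text \<open>The locale states the identity columnwise, for kernels; associativity transfers it to
  every function of \<open>L1\<close>.\<close>

lemma weight_op_first:
  assumes f: "f \<in> L1"
  shows "weight_op w (trunc_on (- S) (weight_op Q f)) = (\<lambda>i. l * (weight_op Q f i - weight_op w f i))"
  unfolding weight_op_trunc_on_kernel[symmetric]
    weight_op_comp[OF w bounded_kernel_trunc_on[OF Q] f] first
  by (simp only: weight_op_kernel_cmult weight_op_kernel_diff[OF Q w f])

lemma weight_op_last:
  assumes f: "f \<in> L1"
  shows "weight_op Q (trunc_on (- S) (weight_op w f)) = (\<lambda>i. l * (weight_op Q f i - weight_op w f i))"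
  unfolding weight_op_trunc_on_kernel[symmetric]
    weight_op_comp[OF Q bounded_kernel_trunc_on[OF w] f] last
  by (simp only: weight_op_kernel_cmult weight_op_kernel_diff[OF Q w f])

lemma weight_op_Q_decomp:
  assumes f: "f \<in> L1"
  shows "weight_op Q f i = weight_op Q (trunc_on S f) i + weight_op Q (trunc_on (- S) f) i"
  by (subst trunc_on_decomp[of f S], subst weight_op_add[OF Q]) (simp_all add: f L1_trunc_on)

text \<open>The image of \<open>f\<close> under 1 + QC/l, the inverse of 1 - TC/l.\<close>

definition reduced_rhs :: "('v \<Rightarrow> complex) \<Rightarrow> 'v \<Rightarrow> complex" where
  "reduced_rhs f i = f i + inverse l * weight_op Q (trunc_on (- S) f) i"

lemma reduced_rhs_L1:
  assumes f: "f \<in> L1"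
  shows "reduced_rhs f \<in> L1"
    and "(\<Sum>\<^sub>\<infinity>i. norm (reduced_rhs f i)) \<le> (1 + C / norm l) * (\<Sum>\<^sub>\<infinity>i. norm (f i))"
proof -
  let ?g = "weight_op Q (trunc_on (- S) f)"
  have g: "?g \<in> L1" by (intro weight_op_L1(1)[OF Q] L1_trunc_on f)
  show "reduced_rhs f \<in> L1"
    unfolding reduced_rhs_def[abs_def] by (intro L1_add L1_cmult f g)
  have "(\<Sum>\<^sub>\<infinity>i. norm (?g i)) \<le> C * (\<Sum>\<^sub>\<infinity>i. norm (trunc_on (- S) f i))"
    by (intro weight_op_L1(2)[OF Q] L1_trunc_on f)
  also have "\<dots> \<le> C * (\<Sum>\<^sub>\<infinity>i. norm (f i))"
    by (intro mult_left_mono infsum_norm_trunc_on_le f bounded_kernel_nonneg[OF Q])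
  finally have g_le: "(\<Sum>\<^sub>\<infinity>i. norm (?g i)) \<le> C * (\<Sum>\<^sub>\<infinity>i. norm (f i))" .
  have "(\<Sum>\<^sub>\<infinity>i. norm (reduced_rhs f i)) \<le> (\<Sum>\<^sub>\<infinity>i. norm (f i)) + (\<Sum>\<^sub>\<infinity>i. norm (inverse l * ?g i))"
    unfolding reduced_rhs_def by (intro infsum_norm_add_le L1_cmult f g)
  also have "(\<Sum>\<^sub>\<infinity>i. norm (inverse l * ?g i)) = (\<Sum>\<^sub>\<infinity>i. norm (?g i)) / norm l"
    by (simp add: norm_mult norm_inverse infsum_cmult_right' divide_inverse mult.commute)
  also have "(\<Sum>\<^sub>\<infinity>i. norm (f i)) + (\<Sum>\<^sub>\<infinity>i. norm (?g i)) / norm l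
      \<le> (\<Sum>\<^sub>\<infinity>i. norm (f i)) + C * (\<Sum>\<^sub>\<infinity>i. norm (f i)) / norm l"
    by (intro add_left_mono divide_right_mono g_le) simp
  finally show "(\<Sum>\<^sub>\<infinity>i. norm (reduced_rhs f i)) \<le> (1 + C / norm l) * (\<Sum>\<^sub>\<infinity>i. norm (f i))"
    by (simp add: algebra_simps)
qed

text \<open>By \<open>weight_op_first\<close>, TCQCf / l = (Q - T) C f, and the summand -TCf cancels
  TCf.\<close>

lemma weight_op_reduced_rhs:
  assumes f: "f \<in> L1"
  shows "weight_op w (trunc_on (- S) (reduced_rhs f)) = weight_op Q (trunc_on (- S) f)"
proof -
  let ?f = "trunc_on (- S) f"
  have f': "?f \<in> L1" by (rule L1_trunc_on[OF f])
  have "trunc_on (- S) (reduced_rhs f)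
      = (\<lambda>i. ?f i + inverse l * trunc_on (- S) (weight_op Q ?f) i)"
    by (auto simp: trunc_on_def reduced_rhs_def)
  then have "weight_op w (trunc_on (- S) (reduced_rhs f))
      = (\<lambda>i. weight_op w ?f i + inverse l * weight_op w (trunc_on (- S) (weight_op Q ?f)) i)"
    by (simp add: weight_op_add[OF w] weight_op_cmult L1_cmult L1_trunc_on weight_op_L1(1)[OF Q] f')
  then show ?thesis using l by (simp add: weight_op_first[OF f'] field_simps)
qed

text \<open>In QCTu = l (Q - T) u, replace CTu by l Cu + Cf. The term QCu then cancels the part of
  Qu that comes from outside \<open>S\<close>.\<close>

lemma reduced_equation:
  assumes u: "u \<in> L1" and f: "f \<in> L1"
    and eq: "\<And>i. weight_op w u i - l * u i = f i"
  shows "weight_op Q (trunc_on S u) i = l * u i + reduced_rhs f i"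
proof -
  have "trunc_on (- S) (weight_op w u) = (\<lambda>i. l * trunc_on (- S) u i + trunc_on (- S) f i)"
    using eq by (auto simp: trunc_on_def algebra_simps)
  then have "l * (weight_op Q u i - weight_op w u i)
      = l * weight_op Q (trunc_on (- S) u) i + weight_op Q (trunc_on (- S) f) i"
    using fun_cong[OF weight_op_last[OF u], of i]
    by (simp add: weight_op_add[OF Q] weight_op_cmult L1_cmult L1_trunc_on u f)
  then show ?thesis
    using eq[of i] l unfolding weight_op_Q_decomp[OF u, of i] reduced_rhs_def
    by (simp add: field_simps)
qed

text \<open>With y = 1_S u, the equation off \<open>S\<close> gives l u = l y + CQy - Ch. Applying
  T, the terms l T y cancel, and what remains is l Q y - QCf = l (l u + f).\<close>

lemma solution_of_reduced_equation:
  assumes u: "u \<in> L1" and f: "f \<in> L1"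
    and eq: "\<And>i. weight_op Q (trunc_on S u) i = l * u i + reduced_rhs f i"
  shows "weight_op w u i - l * u i = f i"
proof -
  let ?y = "trunc_on S u" and ?h = "reduced_rhs f"
  have y: "?y \<in> L1" and h: "?h \<in> L1" by (simp_all add: L1_trunc_on u reduced_rhs_L1 f)
  have "(\<lambda>i. l * u i)
      = (\<lambda>i. (l * ?y i + trunc_on (- S) (weight_op Q ?y) i) - trunc_on (- S) ?h i)"
    using eq by (auto simp: trunc_on_def)
  then have "weight_op w (\<lambda>i. l * u i) i
      = weight_op w (\<lambda>i. (l * ?y i + trunc_on (- S) (weight_op Q ?y) i) - trunc_on (- S) ?h i) i"
    by simp
  then have "l * weight_op w u i
      = l * weight_op w ?y i + l * (weight_op Q ?y i - weight_op w ?y i)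
        - weight_op Q (trunc_on (- S) f) i"
    by (simp add: weight_op_diff[OF w] weight_op_add[OF w] weight_op_cmult L1_add L1_cmult
        L1_trunc_on weight_op_L1(1)[OF Q] y h weight_op_first weight_op_reduced_rhs f)
  also have "\<dots> = l * (l * u i + f i)"
    using eq[of i] l by (simp add: reduced_rhs_def algebra_simps)
  finally show ?thesis using l by simp
qed

lemma reduced_rhs_zero: "reduced_rhs (\<lambda>_. 0) i = 0"
proof -
  have "trunc_on (- S) (\<lambda>_. 0) = (\<lambda>_. 0)" by (auto simp: trunc_on_def)
  then show ?thesis by (simp add: reduced_rhs_def weight_op_def)
qed

lemma reduced_eigenfunction:
  assumes "u \<in> L1" and "\<And>i. weight_op w u i = l * u i"
  shows "weight_op Q (trunc_on S u) i = l * u i"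
proof -
  have "(\<lambda>_. 0) \<in> L1" by (simp add: L1_iff)
  from reduced_equation[OF assms(1) this] assms(2) show ?thesis by (simp add: reduced_rhs_zero)
qed

text \<open>On \<open>S\<close> the function \<open>u\<close> agrees with \<open>v\<close>, so Q 1_S
  u = Q 1_S v = l u holds everywhere: this is the reduced equation for f = 0. The lemma also serves
  injectivity of the reduced map, with \<open>v\<close> a difference of two vectors.\<close>

lemma lifted_eigenfunction:
  assumes fin: "finite S" and eq: "\<And>i. i \<in> S \<Longrightarrow> weight_op Q (trunc_on S v) i = l * v i"
  defines "u \<equiv> \<lambda>i. inverse l * weight_op Q (trunc_on S v) i"
  shows "u \<in> L1" and "\<And>i. i \<in> S \<Longrightarrow> u i = v i" and "weight_op w u = (\<lambda>i. l * u i)"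
proof -
  show u: "u \<in> L1"
    unfolding u_def by (intro L1_cmult weight_op_L1(1)[OF Q] L1_finite_support fin)
  show uv: "u i = v i" if "i \<in> S" for i using eq[OF that] l by (simp add: u_def)
  have z: "(\<lambda>_. 0) \<in> L1" by (simp add: L1_iff)
  have "weight_op Q (trunc_on S u) i = l * u i + reduced_rhs (\<lambda>_. 0) i" for i
    using l by (simp add: trunc_on_eqI[OF uv] reduced_rhs_zero) (simp add: u_def)
  from solution_of_reduced_equation[OF u z this] show "weight_op w u = (\<lambda>i. l * u i)"
    by auto
qed

end

section \<open>Reconstruction\<close>

lemma weight_op_kernel_add:
  assumes "bounded_kernel K c" "bounded_kernel L d" "f \<in> L1"
  shows "weight_op (\<lambda>i j. K i j + L i j) f = (\<lambda>i. weight_op K f i + weight_op L f i)"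
  unfolding weight_op_def distrib_right
  using abs_summable_summable[OF weight_op_L1(3)[OF assms(1,3)]]
    abs_summable_summable[OF weight_op_L1(3)[OF assms(2,3)]]
  by (intro ext infsum_add)

lemma bounded_kernel_add:
  fixes K L :: "'v \<Rightarrow> 'v \<Rightarrow> complex"
  assumes K: "bounded_kernel K c" and L: "bounded_kernel L d"
  shows "bounded_kernel (\<lambda>i j. K i j + L i j) (c + d)"
proof (rule bounded_kernel_columnI)
  fix j
  have K: "(\<lambda>i. K i j) \<in> L1" "(\<Sum>\<^sub>\<infinity>i. norm (K i j)) \<le> c"
    and L: "(\<lambda>i. L i j) \<in> L1" "(\<Sum>\<^sub>\<infinity>i. norm (L i j)) \<le> d"
    using K L by (auto simp: bounded_kernel_def L1_iff)
  show "(\<lambda>i. K i j + L i j) \<in> L1" by (rule L1_add[OF K(1) L(1)])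
  show "(\<Sum>\<^sub>\<infinity>i. norm (K i j + L i j)) \<le> c + d"
    using infsum_norm_add_le[OF K(1) L(1)] K(2) L(2) by linarith
qed

lemma bounded_kernel_cmult:
  fixes K :: "'v \<Rightarrow> 'v \<Rightarrow> complex"
  assumes "bounded_kernel K c"
  shows "bounded_kernel (\<lambda>i j. a * K i j) (norm a * c)"
  using assms by (auto simp: bounded_kernel_def norm_mult infsum_cmult_right'
      intro: summable_on_cmult_right mult_left_mono)

text \<open>The Neumann series is summed pointwise. Since the norms of its terms are dominated by a
  geometric series, Fubini both places the sum in \<open>L1\<close> and lets the operator pass under
  it, in place of an appeal to completeness.\<close>

lemma neumann_solution:
  assumes D: "bounded_kernel D q" and q: "q < 1" and u: "u \<in> L1"
  shows "\<exists>g\<in>L1. \<forall>i. g i = u i + weight_op D g i"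
proof -
  define F where "F k = (weight_op D ^^ k) u" for k
  let ?U = "\<Sum>\<^sub>\<infinity>i. norm (u i)"
  have q0: "q \<ge> 0" by (rule bounded_kernel_nonneg[OF D])
  have F: "F k \<in> L1 \<and> (\<Sum>\<^sub>\<infinity>i. norm (F k i)) \<le> q ^ k * ?U" for k
  proof (induction k)
    case 0
    then show ?case using u by (simp add: F_def)
  next
    case (Suc k)
    then have L: "F k \<in> L1" and le: "(\<Sum>\<^sub>\<infinity>i. norm (F k i)) \<le> q ^ k * ?U" by auto
    have "F (Suc k) = weight_op D (F k)" by (simp add: F_def)
    then show ?case
      using weight_op_L1(1,2)[OF D L] mult_left_mono[OF le q0] by (simp add: mult.assoc)
  qed
  have col: "(\<lambda>i. F k i) abs_summable_on UNIV"
    and le: "(\<Sum>\<^sub>\<infinity>i. norm (F k i)) \<le> q ^ k * ?U" for k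
    using F by (auto simp: L1_iff)
  have geo: "(\<lambda>k. q ^ k * ?U) summable_on UNIV"
    using q q0 by (intro summable_on_cmult_left summable_nonneg_imp_summable_on summable_geometric) auto
  define g where "g i = (\<Sum>\<^sub>\<infinity>k. F k i)" for i
  note cols = abs_summable_columns[where F = "\<lambda>i k. F k i" and A = UNIV and B = UNIV, OF col le geo]
  have g: "g \<in> L1" unfolding g_def[abs_def] L1_iff by (rule cols(4))
  have Fs: "(\<lambda>k. F k i) abs_summable_on UNIV" for i by (rule cols(3)) simp
  have "weight_op D g i = (\<Sum>\<^sub>\<infinity>k. F (Suc k) i)" for i
  proof -
    have Dle: "norm (D i j * F k j) \<le> q * norm (F k j)" for j k
      unfolding norm_mult by (intro mult_right_mono bounded_kernel_entry[OF D]) simp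
    have qF: "(\<lambda>j. q * norm (F k j)) summable_on UNIV" for k
      by (rule summable_on_cmult_right[OF col])
    have Dcol: "(\<lambda>j. D i j * F k j) abs_summable_on UNIV" for k
      by (rule Infinite_Sum.abs_summable_on_comparison_test'[OF qF Dle])
    have Dsum: "(\<Sum>\<^sub>\<infinity>j. norm (D i j * F k j)) \<le> q * (q ^ k * ?U)" for k
    proof -
      have "(\<Sum>\<^sub>\<infinity>j. norm (D i j * F k j)) \<le> (\<Sum>\<^sub>\<infinity>j. q * norm (F k j))"
        by (rule infsum_mono[OF Dcol qF Dle])
      also have "\<dots> \<le> q * (q ^ k * ?U)"
        unfolding infsum_cmult_right' by (rule mult_left_mono[OF le q0])
      finally show ?thesis .
    qed
    have "weight_op D g i = (\<Sum>\<^sub>\<infinity>j. \<Sum>\<^sub>\<infinity>k. D i j * F k j)"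
      by (simp add: weight_op_def g_def infsum_cmult_right')
    also have "\<dots> = (\<Sum>\<^sub>\<infinity>k. \<Sum>\<^sub>\<infinity>j. D i j * F k j)"
      by (rule abs_summable_columns(2)[OF Dcol Dsum summable_on_cmult_right[OF geo]])
    also have "\<dots> = (\<Sum>\<^sub>\<infinity>k. F (Suc k) i)"
      by (simp add: F_def weight_op_def)
    finally show ?thesis .
  qed
  moreover have "g i = u i + (\<Sum>\<^sub>\<infinity>k. F (Suc k) i)" for i
    using infsum_nat_Suc(2)[OF Fs] by (simp add: g_def F_def)
  ultimately have "\<forall>i. g i = u i + weight_op D g i" by simp
  then show ?thesis using g by blast
qed

text \<open>The equations determine the function layer by layer: at a vertex new in layer m + 1 the
  weights to all vertices outside layer m vanish, so the full sum equals the sum over layer m. Type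
  B makes the layers exhaust the vertex set.\<close>

lemma recon_B_eqI:
  assumes B: "structural_B W S" and l: "l \<noteq> 0"
    and on: "\<And>i. i \<in> S \<Longrightarrow> g i = v i"
    and off: "\<And>i. i \<notin> S \<Longrightarrow> l * g i = weight_op W g i"
  shows "recon_B W S l v = g"
proof
  fix i
  obtain m where "i \<in> layer W S m" using layer_exhausts[OF B] by blast
  then show "recon_B W S l v i = g i"
  proof (induction m arbitrary: i)
    case 0
    then show ?case by (simp add: recon_B_base on)
  next
    case (Suc m)
    show ?case
    proof (cases "i \<in> layer W S m")
      case True
      then show ?thesis by (rule Suc.IH)
    next
      case False
      then have i: "i \<in> layer W S (Suc m) - layer W S m" "i \<notin> S"
        using Suc.prems layer_mono[of 0 m W S] by auto
      have "(\<Sum>\<^sub>\<infinity>j\<in>layer W S m. W i j * recon_B W S l v j) = weight_op W g i"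
        unfolding weight_op_def
        by (rule infsum_cong_neutral) (use i(1) Suc.IH in auto)
      then show ?thesis using off[OF i(2)] l by (simp add: recon_B_step[OF i(1)] field_simps)
    qed
  qed
qed

context reduced_kernel
begin

text \<open>The fixed-point operator contains \<open>w - W\<close> once; the factors around it have
  norms at most \<open>1 / norm l\<close> and \<open>1 + C / norm l\<close>, whence the contraction
  constant. The fixed point is then recognized as the reconstruction.\<close>

lemma recon_B_close:
  fixes v :: "'v \<Rightarrow> complex"
  assumes E: "bounded_kernel (\<lambda>i j. w i j - W i j) q"
    and q: "q * ((1 + C / norm l) / norm l) \<le> 1 / 2"
    and B: "structural_B W S" and fin: "finite S"
  defines "u \<equiv> \<lambda>i. trunc_on S v i + inverse l * trunc_on (- S) (weight_op Q (trunc_on S v)) i"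
  shows "recon_B W S l v \<in> L1"
    and "(\<Sum>\<^sub>\<infinity>i. norm (recon_B W S l v i - u i))
      \<le> 2 * (q * ((1 + C / norm l) / norm l)) * (\<Sum>\<^sub>\<infinity>i. norm (u i))"
proof -
  let ?k = "q * ((1 + C / norm l) / norm l)"
  define E' where "E' i j = trunc_on (- S) (\<lambda>z. w z j - W z j) i" for i j
  define P where "P i j = E' i j + inverse l * weight_op Q (\<lambda>z. E' z j) i" for i j
  define D where "D i j = - inverse l * trunc_on (- S) (\<lambda>z. P z j) i" for i j
  have E': "bounded_kernel E' q"
    unfolding E'_def[abs_def] by (rule bounded_kernel_trunc_on[OF E])
  note QE' = bounded_kernel_comp[OF Q E']
  have P: "bounded_kernel P (q + norm (inverse l) * (C * q))"
    unfolding P_def[abs_def] by (intro bounded_kernel_add E' bounded_kernel_cmult QE')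
  have "bounded_kernel D (norm (- inverse l) * (q + norm (inverse l) * (C * q)))"
    unfolding D_def[abs_def] by (intro bounded_kernel_cmult bounded_kernel_trunc_on P)
  also have "norm (- inverse l) * (q + norm (inverse l) * (C * q)) = ?k"
    by (simp add: norm_inverse divide_inverse algebra_simps)
  finally have D: "bounded_kernel D ?k" .
  have v: "trunc_on S v \<in> L1" by (rule L1_finite_support[OF fin])
  have u: "u \<in> L1"
    unfolding u_def by (intro L1_add L1_cmult L1_trunc_on weight_op_L1(1)[OF Q] v)
  have "?k < 1" using q by linarith
  from neumann_solution[OF D this u]
  obtain g where g: "g \<in> L1" and geq: "\<And>i. g i = u i + weight_op D g i" by blast
  let ?E = "weight_op (\<lambda>i j. w i j - W i j) g"
  \<comment> \<open>\<open>y\<close> is what (1 - CT/l) g should be: on \<open>S\<close> the value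
    of \<open>g\<close> is \<open>v\<close>, and off \<open>S\<close> the desired equation
    \<open>l * g i = weight_op W g i\<close> turns g - Tg/l into -(w - W) g / l.\<close>
  define y where "y i = trunc_on S v i - inverse l * trunc_on (- S) ?E i" for i
  have Eg: "?E \<in> L1" by (rule weight_op_L1(1)[OF E g])
  have y: "y \<in> L1" unfolding y_def[abs_def] by (intro L1_diff L1_cmult L1_trunc_on v Eg)
  have E'g: "weight_op E' g = trunc_on (- S) ?E"
    unfolding E'_def[abs_def] by (rule weight_op_trunc_on_kernel)
  have Pg: "weight_op P g = (\<lambda>i. trunc_on (- S) ?E i
      + inverse l * weight_op Q (trunc_on (- S) ?E) i)"
    unfolding P_def[abs_def]
      weight_op_kernel_add[OF E' bounded_kernel_cmult[OF QE'] g] weight_op_kernel_cmult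
      weight_op_comp[OF Q E' g, symmetric] E'g ..
  have Dg: "weight_op D g i = - inverse l * trunc_on (- S) (weight_op P g) i" for i
    unfolding D_def[abs_def] weight_op_kernel_cmult weight_op_trunc_on_kernel ..
  have Qy: "weight_op Q y = (\<lambda>i. weight_op Q (trunc_on S v) i
      - inverse l * weight_op Q (trunc_on (- S) ?E) i)"
    unfolding y_def[abs_def]
    by (simp add: weight_op_diff[OF Q] weight_op_cmult L1_cmult L1_trunc_on v Eg)
  text \<open>$1 + \lambda^{-1} 1_{S^c} Q$ inverts $1 - \lambda^{-1} 1_{S^c} \mathscr A_w$.\<close>
  have gy: "g = (\<lambda>i. y i + inverse l * trunc_on (- S) (weight_op Q y) i)"
    by (rule ext, subst geq)
       (simp add: u_def Dg Pg Qy y_def trunc_on_def algebra_simps)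
  have "weight_op w g i = weight_op w y i
      + inverse l * weight_op w (trunc_on (- S) (weight_op Q y)) i" for i
    by (subst gy) (simp add: weight_op_add[OF w] weight_op_cmult L1_cmult L1_trunc_on
        weight_op_L1(1)[OF Q] y)
  \<comment> \<open>T (1 + CQ/l) = Q.\<close>
  then have wg: "weight_op w g = weight_op Q y"
    using l by (intro ext) (simp add: weight_op_first[OF y] field_simps)
  \<comment> \<open>The available bounds are for \<open>w\<close> and for \<open>w - W\<close>, so
    \<open>W\<close> is expressed by these two.\<close>
  have "weight_op W g = weight_op (\<lambda>i j. w i j - (w i j - W i j)) g" by simp
  then have Wg: "weight_op W g = (\<lambda>i. weight_op Q y i - ?E i)"
    by (simp only: weight_op_kernel_diff[OF w E g] wg)
  have "recon_B W S l v = g"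
  proof (rule recon_B_eqI[OF B l])
    show "g i = v i" if "i \<in> S" for i
      using that by (subst gy) (simp add: y_def trunc_on_def)
    show "l * g i = weight_op W g i" if "i \<notin> S" for i
      using that l unfolding Wg by (subst gy) (simp add: y_def trunc_on_def field_simps)
  qed
  moreover have "(\<Sum>\<^sub>\<infinity>i. norm (g i - u i)) \<le> 2 * ?k * (\<Sum>\<^sub>\<infinity>i. norm (u i))"
  proof -
    let ?G = "\<Sum>\<^sub>\<infinity>i. norm (g i)" and ?U = "\<Sum>\<^sub>\<infinity>i. norm (u i)"
    have "g i - u i = weight_op D g i" for i using geq[of i] by simp
    then have gu: "(\<Sum>\<^sub>\<infinity>i. norm (g i - u i)) \<le> ?k * ?G"
      using weight_op_L1(2)[OF D g] by simp
    have G0: "?G \<ge> 0" by (intro infsum_nonneg) simp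
    \<comment> \<open>Half of \<open>?G\<close> is absorbed on the left, which bounds
      \<open>?G\<close> by \<open>2 * ?U\<close>; hence the factor 2 and the requirement that the
      contraction constant be at most 1/2.\<close>
    have "?G \<le> ?U + (\<Sum>\<^sub>\<infinity>i. norm (g i - u i))"
      using infsum_norm_add_le[OF u L1_diff[OF g u]] by simp
    also have "\<dots> \<le> ?U + 1 / 2 * ?G"
      using gu mult_right_mono[OF q G0] by linarith
    finally have "?k * ?G \<le> ?k * (2 * ?U)"
      by (intro mult_left_mono bounded_kernel_nonneg[OF D]) linarith
    with gu have "(\<Sum>\<^sub>\<infinity>i. norm (g i - u i)) \<le> ?k * (2 * ?U)" by (rule order_trans)
    then show ?thesis by (simp only: mult_ac)
  qed
  ultimately show "recon_B W S l v \<in> L1"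
    and "(\<Sum>\<^sub>\<infinity>i. norm (recon_B W S l v i - u i)) \<le> 2 * ?k * (\<Sum>\<^sub>\<infinity>i. norm (u i))"
    using g by simp_all
qed

end

section \<open>Limits in L1\<close>

lemma ennreal_norm_le_l1_norm:
  fixes f :: "'v \<Rightarrow> complex"
  shows "ennreal (norm (f i)) \<le> l1_norm f"
proof (cases "f abs_summable_on UNIV")
  case True
  then show ?thesis using norm_le_infsum_norm[OF True] by (simp add: l1_norm_abs_summable ennreal_leI)
next
  case False
  then show ?thesis by (simp add: abs_summable_iff_l1_norm not_less top_unique)
qed

text \<open>Each coordinate is dominated by the norm. Uniqueness of complex limits then gives the
  uniqueness that the definite description in \<open>recon_limit\<close> requires.\<close>

lemma L1_limit_pointwise:
  fixes r :: "nat \<Rightarrow> 'v \<Rightarrow> complex"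
  assumes "(\<lambda>n. l1_norm (\<lambda>i. r n i - u i)) \<longlonglongrightarrow> 0"
  shows "(\<lambda>n. r n i) \<longlonglongrightarrow> u i"
proof -
  have "(\<lambda>n. ennreal (norm (r n i - u i))) \<longlonglongrightarrow> 0"
    by (rule tendsto_sandwich[OF _ _ tendsto_const assms])
       (auto intro!: always_eventually ennreal_norm_le_l1_norm[of "\<lambda>i. r n i - u i" for n])
  then have "(\<lambda>n. norm (r n i - u i)) \<longlonglongrightarrow> 0"
    using tendsto_ennreal_iff[where f = "\<lambda>n. norm (r n i - u i)" and x = 0 and F = sequentially]
    by simp
  then show ?thesis by (simp add: tendsto_norm_zero_iff LIM_zero_iff)
qed

lemma recon_limit_eqI:
  assumes "u \<in> L1" "(\<lambda>n. l1_norm (\<lambda>i. recon_B (W n) S l v i - u i)) \<longlonglongrightarrow> 0"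
  shows "recon_limit W S l v = u"
  unfolding recon_limit_def
proof (rule the_equality)
  fix u'
  assume "u' \<in> L1 \<and> (\<lambda>n. l1_norm (\<lambda>i. recon_B (W n) S l v i - u' i)) \<longlonglongrightarrow> 0"
  then show "u' = u"
    using L1_limit_pointwise[OF assms(2)] L1_limit_pointwise[of "\<lambda>n. recon_B (W n) S l v" u']
    by (intro ext) (blast intro: LIMSEQ_unique)
qed (use assms in blast)

context reduced_kernel
begin

lemma recon_B_tendsto:
  fixes v :: "'v \<Rightarrow> complex"
  assumes lim: "(\<lambda>n. norm_1inf (\<lambda>i j. w i j - W n i j)) \<longlonglongrightarrow> 0"
    and B: "\<And>n. structural_B (W n) S" and fin: "finite S"
  defines "u \<equiv> \<lambda>i. trunc_on S v i + inverse l * trunc_on (- S) (weight_op Q (trunc_on S v)) i"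
  shows "(\<lambda>n. l1_norm (\<lambda>i. recon_B (W n) S l v i - u i)) \<longlonglongrightarrow> 0"
proof (rule order_tendstoI)
  fix a :: ennreal
  assume "0 < a"
  \<comment> \<open>\<open>a\<close> may be infinite; a smaller positive \<open>b\<close> is finite
    and hence comes from a real number.\<close>
  then obtain b where b: "0 < b" "b < a" using dense by blast
  then obtain e where e: "b = ennreal e" "e > 0"
    by (cases b) auto
  have u: "u \<in> L1"
    unfolding u_def
    by (intro L1_add L1_cmult L1_trunc_on weight_op_L1(1)[OF Q] L1_finite_support fin)
  have u_eq: "trunc_on S v i + inverse l * trunc_on (- S) (weight_op Q (trunc_on S v)) i = u i" for i
    by (simp add: u_def)
  let ?k = "(1 + C / norm l) / norm l" and ?U = "\<Sum>\<^sub>\<infinity>i. norm (u i)"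
  have k: "?k > 0"
    using l bounded_kernel_nonneg[OF Q] by (intro divide_pos_pos add_pos_nonneg) auto
  have U: "?U \<ge> 0" by (intro infsum_nonneg) simp
  \<comment> \<open>\<open>d\<close> will be the contraction constant: the first bound is the one
    required by \<open>recon_B_close\<close>, the second makes the error at most \<open>e\<close>,
    with + 1 guarding against \<open>?U = 0\<close>.\<close>
  define d where "d = min (1 / 2) (e / (2 * (?U + 1)))"
  have d: "d > 0" using e U by (auto simp: d_def intro!: divide_pos_pos)
  have d2: "d \<le> 1 / 2" unfolding d_def by (rule min.cobounded1)
  have dU: "2 * d * ?U \<le> e"
  proof -
    have "2 * d * ?U \<le> 2 * (e / (2 * (?U + 1))) * ?U"
      using U by (intro mult_right_mono mult_left_mono) (auto simp: d_def)
    also have "\<dots> \<le> e" using U e by (simp add: field_simps)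
    finally show ?thesis .
  qed
  have "\<forall>\<^sub>F n in sequentially. norm_1inf (\<lambda>i j. w i j - W n i j) < ennreal (d / ?k)"
    using divide_pos_pos[OF d k] by (intro order_tendstoD(2)[OF lim]) (simp only: ennreal_less_zero_iff)
  then show "\<forall>\<^sub>F n in sequentially. l1_norm (\<lambda>i. recon_B (W n) S l v i - u i) < a"
  proof eventually_elim
    case (elim n)
    then have E: "bounded_kernel (\<lambda>i j. w i j - W n i j) (d / ?k)"
      using divide_pos_pos[OF d k] by (intro bounded_kernelI less_imp_le)
    have "d / x * x = d" if "x > 0" for x using that by simp
    note dk = this[OF k]
    note close = recon_B_close[OF E _ B[of n] fin, where v = v, unfolded dk u_eq]
    have "(\<lambda>i. recon_B (W n) S l v i - u i) \<in> L1"
      by (rule L1_diff[OF close(1)[OF d2] u])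
    then have "l1_norm (\<lambda>i. recon_B (W n) S l v i - u i)
        = ennreal (\<Sum>\<^sub>\<infinity>i. norm (recon_B (W n) S l v i - u i))"
      by (intro l1_norm_abs_summable) (simp add: L1_iff)
    also have "\<dots> \<le> ennreal e"
      by (rule ennreal_leI[OF order_trans[OF close(2)[OF d2] dU]])
    finally show ?case using b(2) e(1) by simp
  qed
qed simp

end


section \<open>The spectrum\<close>

text \<open>Preimages \<open>e k\<close> of the unit vectors give v as the sum of (A v)_k times
  \<open>e k\<close>: both sides have the same image, and the map is injective. \<open>K\<close> is
  the total size of these preimages.\<close>

lemma bij_matrix_bounded_below:
  fixes A :: "'v \<Rightarrow> 'v \<Rightarrow> complex"
  assumes fin: "finite S"
    and bij: "bij_betw (\<lambda>v. \<lambda>i\<in>S. \<Sum>j\<in>S. A i j * v j) (S \<rightarrow>\<^sub>E UNIV) (S \<rightarrow>\<^sub>E UNIV)"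
  obtains K where "K \<ge> 0"
    and "\<And>v. v \<in> S \<rightarrow>\<^sub>E UNIV \<Longrightarrow> (\<Sum>j\<in>S. norm (v j)) \<le> K * (\<Sum>i\<in>S. norm (\<Sum>j\<in>S. A i j * v j))"
proof -
  let ?B = "\<lambda>v. \<lambda>i\<in>S. \<Sum>j\<in>S. A i j * v j"
  have onto: "(\<lambda>i\<in>S. if i = k then 1 else 0) \<in> ?B ` (S \<rightarrow>\<^sub>E UNIV)" for k
    using bij unfolding bij_betw_def by auto
  define e where "e k = inv_into (S \<rightarrow>\<^sub>E UNIV) ?B (\<lambda>i\<in>S. if i = k then 1 else 0)" for k
  have Be: "?B (e k) = (\<lambda>i\<in>S. if i = k then 1 else 0)" for k
    unfolding e_def by (rule f_inv_into_f[OF onto])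
  have Be': "(\<Sum>j\<in>S. A i j * e k j) = (if i = k then 1 else 0)" if "i \<in> S" for i k
    using fun_cong[OF Be[of k], of i] that by simp
  define K where "K = (\<Sum>k\<in>S. \<Sum>j\<in>S. norm (e k j))"
  show ?thesis
  proof (rule that)
    show "K \<ge> 0" unfolding K_def by (intro sum_nonneg) simp
    fix v :: "'v \<Rightarrow> complex"
    assume v: "v \<in> S \<rightarrow>\<^sub>E UNIV"
    let ?a = "\<lambda>i. \<Sum>j\<in>S. A i j * v j"
    let ?v = "\<lambda>j\<in>S. \<Sum>k\<in>S. ?a k * e k j"
    have "?B ?v = ?B v"
    proof (rule restrict_ext)
      fix i assume i: "i \<in> S"
      have "(\<Sum>j\<in>S. A i j * ?v j) = (\<Sum>j\<in>S. \<Sum>k\<in>S. ?a k * (A i j * e k j))"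
        by (intro sum.cong refl) (simp add: sum_distrib_left mult.left_commute)
      also have "\<dots> = (\<Sum>k\<in>S. \<Sum>j\<in>S. ?a k * (A i j * e k j))" by (rule sum.swap)
      also have "\<dots> = (\<Sum>k\<in>S. ?a k * (if i = k then 1 else 0))"
        by (simp only: sum_distrib_left[symmetric] Be'[OF i])
      also have "\<dots> = (\<Sum>k\<in>S. if i = k then ?a k else 0)" by (intro sum.cong) auto
      also have "\<dots> = ?a i" using fin i by simp
      finally show "(\<Sum>j\<in>S. A i j * ?v j) = ?a i" .
    qed
    moreover have "?v \<in> S \<rightarrow>\<^sub>E UNIV" by simp
    ultimately have "?v = v" using inj_onD[OF bij_betw_imp_inj_on[OF bij]] v by blast
    then have v_eq: "v = ?v" by (rule sym)
    have veq: "v j = (\<Sum>k\<in>S. ?a k * e k j)" if "j \<in> S" for j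
    proof -
      have "v j = ?v j" by (rule fun_cong[OF v_eq])
      also have "\<dots> = (\<Sum>k\<in>S. ?a k * e k j)" using that by simp
      finally show ?thesis .
    qed
    have "(\<Sum>j\<in>S. norm (v j)) = (\<Sum>j\<in>S. norm (\<Sum>k\<in>S. ?a k * e k j))"
      by (intro sum.cong refl arg_cong[of _ _ norm] veq)
    also have "\<dots> \<le> (\<Sum>j\<in>S. \<Sum>k\<in>S. norm (?a k) * norm (e k j))"
      by (intro sum_mono order_trans[OF norm_sum]) (simp add: norm_mult)
    also have "\<dots> = (\<Sum>k\<in>S. norm (?a k) * (\<Sum>j\<in>S. norm (e k j)))"
      by (subst sum.swap) (simp add: sum_distrib_left)
    also have "\<dots> \<le> (\<Sum>k\<in>S. norm (?a k) * K)"
      unfolding K_def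
      by (intro sum_mono mult_left_mono member_le_sum fin) (auto intro: sum_nonneg)
    also have "\<dots> = K * (\<Sum>k\<in>S. norm (?a k))" by (simp add: sum_distrib_left mult.commute)
    finally show "(\<Sum>j\<in>S. norm (v j)) \<le> K * (\<Sum>i\<in>S. norm (?a i))" .
  qed
qed

lemma infsum_norm_trunc_on_finite:
  assumes "finite S"
  shows "(\<Sum>\<^sub>\<infinity>i. norm (trunc_on S f i)) = (\<Sum>i\<in>S. norm (f i))"
proof -
  have "(\<Sum>\<^sub>\<infinity>i. norm (trunc_on S f i)) = (\<Sum>\<^sub>\<infinity>i\<in>S. norm (f i))"
    by (rule infsum_cong_neutral) (auto simp: trunc_on_def)
  then show ?thesis using assms by simp
qed

context reduced_kernel
begin

definition shifted_reduced :: "('v \<Rightarrow> complex) \<Rightarrow> 'v \<Rightarrow> complex" where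
  "shifted_reduced v = (\<lambda>i\<in>S. weight_op Q (trunc_on S v) i - l * v i)"

text \<open>A null vector of the reduced map lifts to a null vector of T - l, hence vanishes. A
  target \<open>h\<close> is reached by solving (T - l) u = 1_S h and restricting \<open>u\<close>,
  because \<open>reduced_rhs\<close> fixes functions supported in \<open>S\<close>.\<close>

lemma bij_of_invertible:
  assumes fin: "finite S" and inv: "L1_invertible (\<lambda>f i. weight_op w f i - l * f i)"
  shows "bij_betw shifted_reduced (S \<rightarrow>\<^sub>E UNIV) (S \<rightarrow>\<^sub>E UNIV)"
proof -
  obtain U where U: "L1_bounded_op U"
    and UT: "\<And>f. f \<in> L1 \<Longrightarrow> U (\<lambda>i. weight_op w f i - l * f i) = f"
    and TU: "\<And>f. f \<in> L1 \<Longrightarrow> (\<lambda>i. weight_op w (U f) i - l * U f i) = f"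
    using inv unfolding L1_invertible_def by blast
  have z: "(\<lambda>_. 0) \<in> L1" by (simp add: L1_iff)
  have "inj_on shifted_reduced (S \<rightarrow>\<^sub>E UNIV)"
  proof (rule inj_onI)
    fix a b assume ab: "a \<in> S \<rightarrow>\<^sub>E UNIV" "b \<in> S \<rightarrow>\<^sub>E UNIV" "shifted_reduced a = shifted_reduced b"
    define d where "d i = a i - b i" for i
    have "trunc_on S d = (\<lambda>i. trunc_on S a i - trunc_on S b i)"
      by (auto simp: trunc_on_def d_def)
    then have "weight_op Q (trunc_on S d) i = l * d i" if "i \<in> S" for i
      using fun_cong[OF ab(3), of i] that
      by (simp add: weight_op_diff[OF Q] L1_finite_support fin shifted_reduced_def d_def algebra_simps)
    note lift = lifted_eigenfunction[OF fin this]
    let ?u = "\<lambda>i. inverse l * weight_op Q (trunc_on S d) i"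
    have u: "?u \<in> L1" "weight_op w ?u = (\<lambda>i. l * ?u i)" "\<And>i. i \<in> S \<Longrightarrow> ?u i = d i"
      using lift by simp_all
    have Tu: "(\<lambda>i. weight_op w ?u i - l * ?u i) = (\<lambda>_. 0)" by (simp only: u(2) diff_self)
    have T0: "(\<lambda>i. weight_op w (\<lambda>_. 0) i - l * 0) = (\<lambda>_. 0)" by (simp add: weight_op_def)
    have "?u = (\<lambda>_. 0)"
      using UT[OF u(1), unfolded Tu] UT[OF z, unfolded T0] by (rule trans[OF sym])
    then have "d i = 0" if "i \<in> S" for i using u(3)[OF that] by metis
    then show "a = b" using ab(1,2) by (intro PiE_ext) (auto simp: d_def)
  qed
  moreover have "h \<in> shifted_reduced ` (S \<rightarrow>\<^sub>E UNIV)" if h: "h \<in> S \<rightarrow>\<^sub>E UNIV" for h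
  proof
    let ?f = "trunc_on S h"
    let ?u = "U ?f"
    have f: "?f \<in> L1" by (rule L1_finite_support[OF fin])
    have u: "?u \<in> L1" using U f unfolding L1_bounded_op_def by blast
    have "trunc_on (- S) ?f = (\<lambda>_. 0)" by (auto simp: trunc_on_def)
    then have "reduced_rhs ?f i = ?f i" for i by (simp add: reduced_rhs_def weight_op_def)
    then have eq: "weight_op Q (trunc_on S ?u) i = l * ?u i + ?f i" for i
      using reduced_equation[OF u f] fun_cong[OF TU[OF f]] by simp
    have "trunc_on S (restrict ?u S) = trunc_on S ?u" by (rule trunc_on_eqI) simp
    then have "shifted_reduced (restrict ?u S) i = h i" for i
      by (cases "i \<in> S") (simp_all add: shifted_reduced_def eq trunc_on_def PiE_arb[OF h])
    then show "h = shifted_reduced (restrict ?u S)" by auto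
  qed simp
  moreover have "shifted_reduced v \<in> S \<rightarrow>\<^sub>E UNIV" for v
    by (simp add: shifted_reduced_def)
  ultimately show ?thesis unfolding bij_betw_def by blast
qed

text \<open>The inverse is explicit: \<open>V f\<close> solves the reduced equation on
  \<open>S\<close>, and \<open>U f\<close> is read off from l u = Q 1_S (V f) - h. Its bound comes
  from the matrix bound on C^S.\<close>

lemma invertible_of_bij:
  assumes fin: "finite S" and bij: "bij_betw shifted_reduced (S \<rightarrow>\<^sub>E UNIV) (S \<rightarrow>\<^sub>E UNIV)"
  shows "L1_invertible (\<lambda>f i. weight_op w f i - l * f i)"
proof -
  let ?T = "\<lambda>f i. weight_op w f i - l * f i"
  let ?A = "\<lambda>i j. Q i j - (if i = j then l else 0)"
  have row: "(\<Sum>j\<in>S. ?A i j * v j) = weight_op Q (trunc_on S v) i - l * v i" if "i \<in> S" for i v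
  proof -
    have "(\<Sum>j\<in>S. ?A i j * v j) = (\<Sum>j\<in>S. Q i j * v j - (if i = j then l * v j else 0))"
      by (intro sum.cong) (auto simp: left_diff_distrib)
    then show ?thesis using fin that by (simp add: sum_subtractf weight_op_trunc_on_finite)
  qed
  have A: "shifted_reduced = (\<lambda>v. \<lambda>i\<in>S. \<Sum>j\<in>S. ?A i j * v j)"
    unfolding shifted_reduced_def by (intro ext) (simp add: row restrict_def)
  obtain K where K: "K \<ge> 0" and bound: "\<And>v. v \<in> S \<rightarrow>\<^sub>E UNIV \<Longrightarrow>
      (\<Sum>j\<in>S. norm (v j)) \<le> K * (\<Sum>i\<in>S. norm (\<Sum>j\<in>S. ?A i j * v j))"
    using bij_matrix_bounded_below[OF fin bij[unfolded A]] by blast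
  define V where "V f = inv_into (S \<rightarrow>\<^sub>E UNIV) shifted_reduced (restrict (reduced_rhs f) S)" for f
  define U where "U f i = inverse l * (weight_op Q (trunc_on S (V f)) i - reduced_rhs f i)" for f i
  have onto: "restrict (reduced_rhs f) S \<in> shifted_reduced ` (S \<rightarrow>\<^sub>E UNIV)" for f
    using bij unfolding bij_betw_def by simp
  have V: "V f \<in> S \<rightarrow>\<^sub>E UNIV" "shifted_reduced (V f) = restrict (reduced_rhs f) S" for f
    unfolding V_def by (rule inv_into_into[OF onto], rule f_inv_into_f[OF onto])
  have Veq: "weight_op Q (trunc_on S (V f)) i - l * V f i = reduced_rhs f i" if "i \<in> S" for f i
    using fun_cong[OF V(2)[of f], of i] that by (simp add: shifted_reduced_def)
  \<comment> \<open>\<open>V f\<close> solves the reduced equation on \<open>S\<close>, so the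
    formula for \<open>U f\<close> returns \<open>V f\<close> there and truly extends it.\<close>
  have UV: "U f i = V f i" if "i \<in> S" for f i
    using Veq[OF that, of f] l by (simp add: U_def field_simps)
  have VL: "trunc_on S (V f) \<in> L1" for f by (rule L1_finite_support[OF fin])
  have UL: "U f \<in> L1" if "f \<in> L1" for f
    unfolding U_def[abs_def] using that
    by (intro L1_cmult L1_diff weight_op_L1(1)[OF Q] VL reduced_rhs_L1)
  have TU: "?T (U f) = f" if f: "f \<in> L1" for f
  proof
    fix i
    have "weight_op Q (trunc_on S (U f)) i = l * U f i + reduced_rhs f i" for i
      using l by (simp add: trunc_on_eqI[OF UV] U_def mult.assoc[symmetric])
    from solution_of_reduced_equation[OF UL[OF f] f this] show "?T (U f) i = f i" .
  qed
  have T_L1: "?T u \<in> L1" if "u \<in> L1" for u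
    using that by (intro L1_diff L1_cmult weight_op_L1(1)[OF w])
  have UT: "U (?T u) = u" if u: "u \<in> L1" for u
  proof -
    let ?f = "?T u"
    have eq: "weight_op Q (trunc_on S u) i = l * u i + reduced_rhs ?f i" for i
      by (rule reduced_equation[OF u T_L1[OF u] refl])
    have tr: "trunc_on S (restrict u S) = trunc_on S u" by (rule trunc_on_eqI) simp
    have "shifted_reduced (restrict u S) = restrict (reduced_rhs ?f) S"
      unfolding shifted_reduced_def by (rule restrict_ext) (simp add: tr eq)
    moreover have "inv_into (S \<rightarrow>\<^sub>E UNIV) shifted_reduced (shifted_reduced (restrict u S)) = restrict u S"
      by (rule bij_betw_inv_into_left[OF bij]) simp
    ultimately have "V ?f = restrict u S" by (simp only: V_def)
    then show ?thesis using l by (intro ext) (simp add: U_def tr eq)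
  qed
  \<comment> \<open>\<open>1 + C / norm l\<close> bounds the passage from f to h, \<open>K\<close>
    the solution on \<open>S\<close>, \<open>C\<close> the operator Q, the summand 1 the term -h,
    and \<open>inverse (norm l)\<close> is the factor in \<open>U\<close>.\<close>
  have U_norm: "l1_norm (U f) \<le> ennreal (inverse (norm l) * ((C * K + 1) * (1 + C / norm l))) * l1_norm f"
    if f: "f \<in> L1" for f
  proof -
    let ?h = "reduced_rhs f" and ?q = "weight_op Q (trunc_on S (V f))"
    let ?H = "\<Sum>\<^sub>\<infinity>i. norm (?h i)" and ?F = "\<Sum>\<^sub>\<infinity>i. norm (f i)"
    have C: "C \<ge> 0" by (rule bounded_kernel_nonneg[OF Q])
    have h: "?h \<in> L1" by (rule reduced_rhs_L1(1)[OF f])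
    have q: "?q \<in> L1" by (rule weight_op_L1(1)[OF Q VL])
    have "(\<Sum>i\<in>S. norm (V f i)) \<le> K * (\<Sum>i\<in>S. norm (?h i))"
      using bound[OF V(1)[of f]] by (simp add: row Veq)
    also have "(\<Sum>i\<in>S. norm (?h i)) = (\<Sum>\<^sub>\<infinity>i. norm (trunc_on S ?h i))"
      by (rule infsum_norm_trunc_on_finite[OF fin, symmetric])
    also have "K * \<dots> \<le> K * ?H"
      by (intro mult_left_mono infsum_norm_trunc_on_le h K)
    finally have v_le: "(\<Sum>i\<in>S. norm (V f i)) \<le> K * ?H" .
    have "(\<Sum>\<^sub>\<infinity>i. norm (?q i)) \<le> C * (\<Sum>i\<in>S. norm (V f i))"
      using weight_op_L1(2)[OF Q VL[of f]] by (simp add: infsum_norm_trunc_on_finite[OF fin])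
    also have "\<dots> \<le> C * (K * ?H)" by (rule mult_left_mono[OF v_le C])
    finally have q_le: "(\<Sum>\<^sub>\<infinity>i. norm (?q i)) \<le> C * (K * ?H)" .
    have "(\<Sum>\<^sub>\<infinity>i. norm (?q i - ?h i)) \<le> (\<Sum>\<^sub>\<infinity>i. norm (?q i)) + ?H"
      using infsum_norm_add_le[OF q L1_cmult[OF h, of "-1"]] by simp
    also have "\<dots> \<le> (C * K + 1) * ?H" using q_le by (simp add: algebra_simps)
    also have "\<dots> \<le> (C * K + 1) * ((1 + C / norm l) * ?F)"
      using C K by (intro mult_left_mono reduced_rhs_L1(2)[OF f]) simp
    finally have "(\<Sum>\<^sub>\<infinity>i. norm (U f i)) \<le> inverse (norm l) * ((C * K + 1) * ((1 + C / norm l) * ?F))"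
      unfolding U_def norm_mult norm_inverse infsum_cmult_right'
      by (intro mult_left_mono) auto
    then have "ennreal (\<Sum>\<^sub>\<infinity>i. norm (U f i))
        \<le> ennreal (inverse (norm l) * ((C * K + 1) * (1 + C / norm l)) * ?F)"
      by (intro ennreal_leI) (simp add: mult.assoc)
    also have "\<dots> = ennreal (inverse (norm l) * ((C * K + 1) * (1 + C / norm l))) * ennreal ?F"
      using C K by (intro ennreal_mult mult_nonneg_nonneg add_nonneg_nonneg infsum_nonneg) auto
    finally show ?thesis
      using f UL[OF f] by (simp add: l1_norm_abs_summable L1_iff)
  qed
  \<comment> \<open>Linearity is inherited from T - l through the two inverse laws, so
    \<open>inv_into\<close> in \<open>V\<close> need not be analysed.\<close>
  have add: "U (\<lambda>i. f i + g i) = (\<lambda>i. U f i + U g i)" if f: "f \<in> L1" and g: "g \<in> L1" for f g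
  proof -
    have "?T (\<lambda>i. U f i + U g i) = (\<lambda>i. ?T (U f) i + ?T (U g) i)"
      by (simp add: weight_op_add[OF w UL[OF f] UL[OF g]] algebra_simps)
    then have "?T (\<lambda>i. U f i + U g i) = (\<lambda>i. f i + g i)" using TU[OF f] TU[OF g] by metis
    then show ?thesis using UT[OF L1_add[OF UL[OF f] UL[OF g]]] by simp
  qed
  have cmult: "U (\<lambda>i. a * f i) = (\<lambda>i. a * U f i)" if f: "f \<in> L1" for a f
  proof -
    have "?T (\<lambda>i. a * U f i) = (\<lambda>i. a * ?T (U f) i)"
      by (simp add: weight_op_cmult algebra_simps)
    then have "?T (\<lambda>i. a * U f i) = (\<lambda>i. a * f i)" using TU[OF f] by metis
    then show ?thesis using UT[OF L1_cmult[OF UL[OF f], of a]] by simp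
  qed
  have "L1_bounded_op U"
    unfolding L1_bounded_op_def using UL add cmult U_norm by blast
  then show ?thesis unfolding L1_invertible_def using UT TU by blast
qed

end

section \<open>Transfer to the notions of the theorem\<close>

lemma reduced_op_eq_weight_op:
  assumes "finite S" "i \<in> S"
  shows "reduced_op w S l v i = weight_op (reduced_matrix w S l) (trunc_on S v) i"
  using assms by (simp add: reduced_op_def weight_op_trunc_on_finite)

lemma fin_eigenfunction_reduced_op_iff:
  assumes fin: "finite S"
  shows "fin_eigenfunction S (reduced_op w S l) l v \<longleftrightarrow>
    v \<in> S \<rightarrow>\<^sub>E UNIV \<and> (\<exists>i\<in>S. v i \<noteq> 0) \<and>
    (\<forall>i\<in>S. weight_op (reduced_matrix w S l) (trunc_on S v) i = l * v i)"
proof -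
  have "reduced_op w S l v = (\<lambda>i\<in>S. l * v i) \<longleftrightarrow>
      (\<forall>i\<in>S. weight_op (reduced_matrix w S l) (trunc_on S v) i = l * v i)"
    unfolding reduced_op_def weight_op_trunc_on_finite[OF fin]
    by (auto simp: restrict_def fun_eq_iff)
  then show ?thesis by (simp add: fin_eigenfunction_def)
qed

context
  fixes w :: "'v \<Rightarrow> 'v \<Rightarrow> complex" and S :: "'v set" and l :: complex and c C :: real
  assumes red: "reduced_kernel w (reduced_matrix w S l) S l c C" and fin: "finite S"
begin

interpretation reduced_kernel w "reduced_matrix w S l" S l c C by (rule red)

lemma mem_spectrum_iff: "l \<in> L1_spectrum (weight_op w) \<longleftrightarrow> l \<in> reduced_spectrum w S"
proof -
  have "(\<lambda>v. \<lambda>i\<in>S. reduced_op w S l v i - l * v i) = shifted_reduced"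
    unfolding shifted_reduced_def[abs_def]
    by (intro ext) (simp add: restrict_def reduced_op_eq_weight_op[OF fin])
  then show ?thesis
    using bij_of_invertible[OF fin] invertible_of_bij[OF fin] l
    by (auto simp: L1_spectrum_def reduced_spectrum_def)
qed

text \<open>The restriction cannot vanish: l u = Q 1_S u recovers \<open>u\<close> everywhere from
  its values on \<open>S\<close>.\<close>

lemma fin_eigenfunction_restrict:
  assumes u: "L1_eigenfunction (weight_op w) l u"
  shows "fin_eigenfunction S (reduced_op w S l) l (restrict u S)"
proof -
  have "u \<in> L1" "\<And>i. weight_op w u i = l * u i"
    using u by (auto simp: L1_eigenfunction_def)
  note eq = reduced_eigenfunction[OF this]
  have tr: "trunc_on S (restrict u S) = trunc_on S u" by (rule trunc_on_eqI) simp
  have "\<exists>i\<in>S. u i \<noteq> 0"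
  proof (rule ccontr)
    assume "\<not> (\<exists>i\<in>S. u i \<noteq> 0)"
    then have "trunc_on S u = (\<lambda>_. 0)" by (auto simp: trunc_on_def)
    then have "u = (\<lambda>_. 0)" using eq l by (auto simp: weight_op_def)
    then show False using u by (simp add: L1_eigenfunction_def)
  qed
  then show ?thesis using eq by (simp add: fin_eigenfunction_reduced_op_iff[OF fin] tr)
qed

lemma L1_eigenfunction_lift:
  assumes v: "fin_eigenfunction S (reduced_op w S l) l v"
  shows "L1_eigenfunction (weight_op w) l
    (\<lambda>i. inverse l * weight_op (reduced_matrix w S l) (trunc_on S v) i)" (is "L1_eigenfunction _ _ ?u")
proof -
  obtain k where k: "k \<in> S" "v k \<noteq> 0"
    and eq: "\<And>i. i \<in> S \<Longrightarrow> weight_op (reduced_matrix w S l) (trunc_on S v) i = l * v i"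
    using v by (auto simp: fin_eigenfunction_reduced_op_iff[OF fin])
  note lift = lifted_eigenfunction[OF fin eq]
  have "?u k = v k" by (rule lift(2)) (use k in auto)
  then have "?u \<noteq> (\<lambda>_. 0)" using k(2) by (metis (lifting))
  then show ?thesis using lift(1,3) unfolding L1_eigenfunction_def by simp
qed

text \<open>The reconstructions tend to the function that is \<open>v\<close> on \<open>S\<close>
  and Q 1_S v / l off \<open>S\<close>. The eigenvalue equation makes the second formula valid on
  \<open>S\<close> too.\<close>

lemma recon_limit_eq_lift:
  assumes W: "structural_A_quasi_B_via w S W" and v: "fin_eigenfunction S (reduced_op w S l) l v"
  shows "recon_limit W S l v
    = (\<lambda>i. inverse l * weight_op (reduced_matrix w S l) (trunc_on S v) i)" (is "_ = ?u")
proof (rule recon_limit_eqI)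
  show "?u \<in> L1" using L1_eigenfunction_lift[OF v] by (simp add: L1_eigenfunction_def)
  have u_eq: "trunc_on S v i
      + inverse l * trunc_on (- S) (weight_op (reduced_matrix w S l) (trunc_on S v)) i = ?u i" for i
    using v l by (cases "i \<in> S")
      (simp_all add: fin_eigenfunction_reduced_op_iff[OF fin] trunc_on_def[of _ _ i])
  have "(\<lambda>n. norm_1inf (\<lambda>i j. w i j - W n i j)) \<longlonglongrightarrow> 0" "structural_B (W n) S" for n
    using W by (auto simp: structural_A_quasi_B_via_def)
  from recon_B_tendsto[OF this fin, where v = v]
  show "(\<lambda>n. l1_norm (\<lambda>i. recon_B (W n) S l v i - ?u i)) \<longlonglongrightarrow> 0"
    by (simp only: u_eq)
qed

end

theorem theorem4p2:
  fixes w :: "'v \<Rightarrow> 'v \<Rightarrow> complex" and S :: "'v set"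
  assumes "countable (UNIV :: 'v set)" and "infinite (UNIV :: 'v set)"
    and "finite S"
    and "bounded_1inf w"
    and "structural_A_quasi_B w S"
  shows "L1_spectrum (weight_op w) - {0} = reduced_spectrum w S \<and>
    (\<forall>l. l \<noteq> 0 \<longrightarrow>
       (L1_eigenvalue (weight_op w) l \<longleftrightarrow> fin_eigenvalue S (reduced_op w S l) l)) \<and>
    (\<forall>l u. l \<noteq> 0 \<longrightarrow> L1_eigenfunction (weight_op w) l u \<longrightarrow>
       fin_eigenfunction S (reduced_op w S l) l (restrict u S)) \<and>
    (\<forall>l v W. l \<noteq> 0 \<longrightarrow> structural_A_quasi_B_via w S W \<longrightarrow>
       fin_eigenfunction S (reduced_op w S l) l v \<longrightarrow>
       L1_eigenfunction (weight_op w) l (recon_limit W S l v))"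
proof -
  obtain c where c: "bounded_kernel w c" using assms(4) by (rule bounded_1infE)
  have A: "structural_A w S"
    using assms(5) by (auto simp: structural_A_quasi_B_def structural_A_quasi_B_via_def)
  have red: "\<exists>C. reduced_kernel w (reduced_matrix w S l) S l c C" if "l \<noteq> 0" for l
    by (rule reduced_kernel_reduced_matrix[OF c A that])
  have spectrum: "l \<in> L1_spectrum (weight_op w) \<longleftrightarrow> l \<in> reduced_spectrum w S" if "l \<noteq> 0" for l
    using red[OF that] mem_spectrum_iff[OF _ assms(3)] by blast
  have down: "fin_eigenfunction S (reduced_op w S l) l (restrict u S)"
    if "l \<noteq> 0" "L1_eigenfunction (weight_op w) l u" for l u
    using red[OF that(1)] fin_eigenfunction_restrict[OF _ assms(3) that(2)] by blast
  have up: "L1_eigenfunction (weight_op w) l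
      (\<lambda>i. inverse l * weight_op (reduced_matrix w S l) (trunc_on S v) i)"
    if "l \<noteq> 0" "fin_eigenfunction S (reduced_op w S l) l v" for l v
    using red[OF that(1)] L1_eigenfunction_lift[OF _ assms(3) that(2)] by blast
  have limit: "L1_eigenfunction (weight_op w) l (recon_limit W S l v)"
    if "l \<noteq> 0" "structural_A_quasi_B_via w S W" "fin_eigenfunction S (reduced_op w S l) l v" for l v W
    using red[OF that(1)] recon_limit_eq_lift[OF _ assms(3) that(2,3)] up[OF that(1,3)] by auto
  show ?thesis
  proof (intro conjI allI impI)
    show "L1_spectrum (weight_op w) - {0} = reduced_spectrum w S"
      using spectrum by (auto simp: reduced_spectrum_def)
    show "L1_eigenvalue (weight_op w) l \<longleftrightarrow> fin_eigenvalue S (reduced_op w S l) l" if "l \<noteq> 0" for l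
      unfolding L1_eigenvalue_def fin_eigenvalue_def using down[OF that] up[OF that] by blast
  qed (fact down limit)+
qed

end
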